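(* There are absolute constants $c, c' > 0$ such that the following holds. Let $\lambda \in (0,1]$, let $\Phi:\mathrm{Mat}(p)\to\mathrm{Mat}(n)$ be a $(1-\lambda)$-quantum expander, and let $Z_0 \in \mathrm{PD}(p)$ satisfy $\|\nabla f^{\Phi}(Z_0)\|_F \leq c\lambda^2$. Then for every $T \geq 0$, the $T$-th Sinkhorn iterate $Z_T$ starting at $Z_0$ satisfies $$\|\nabla f^{\Phi}(Z_T)\|_F \leq \exp(-c'\lambda T).$$
   Context: $\mathrm{PD}(p)$ is the set of $p\times p$ positive-definite matrices. A completely positive map $\Phi:\mathrm{Mat}(p)\to\mathrm{Mat}(n)$ is $\Phi(Y) = \sum_{i=1}^r A_i Y A_i^\dagger$ with $A_i \in \mathbb{C}^{n\times p}$; $s(\Phi) = \operatorname{tr}\Phi(I_p)$; $\Phi^*(Y) = \sum_i A_i^\dagger Y A_i$. $\Phi$ is a $(1-\lambda)$-quantum expander if $\Phi(I_p) = s(\Phi)I_n/n$, $\Phi^*(I_n) = s(\Phi)I_p/p$, and $\|\Phi(X)\|_F \leq (1-\lambda)\frac{s(\Phi)}{\sqrt{np}}\|X\|_F$ for all Hermitian $p\times p$ $X$ with $\operatorname{tr}X = 0$. Define $f^{\Phi}(Z) = \frac{p}{n}\log\det\Phi(Z) - \log\det Z$ for $Z\in\mathrm{PD}(p)$, with geodesic gradient $\nabla f^{\Phi}(Z) = \frac{p}{n}\sqrt{Z}\,\Phi^*(\Phi(Z)^{-1})\sqrt{Z} - I_p$. The Sinkhorn iterates starting at $Z_0$ are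 defined by $Z_t^{-1} = \frac{p}{n}\Phi^*(\Phi(Z_{t-1})^{-1})$ for $t \geq 1$. *)

theory Defs
  imports
    Complex_Main
    "Jordan_Normal_Form.Gauss_Jordan_Elimination"
    "Jordan_Normal_Form.Schur_Decomposition"
begin

definition mat_trace :: "complex mat \<Rightarrow> complex" where
  "mat_trace A = (\<Sum>i<dim_row A. A $$ (i, i))"

definition frobenius_norm :: "complex mat \<Rightarrow> real" where
  "frobenius_norm A = sqrt (\<Sum>i<dim_row A. \<Sum>j<dim_col A. (cmod (A $$ (i, j)))\<^sup>2)"

definition hermitian_mat :: "nat \<Rightarrow> complex mat \<Rightarrow> bool" where
  "hermitian_mat n A \<longleftrightarrow> A \<in> carrier_mat n n \<and> mat_adjoint A = A"

text \<open>The quadratic form of a Hermitian matrix is real, so taking the real part loses nothing.\<close>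

definition PD :: "nat \<Rightarrow> complex mat set" where
  "PD n = {A. hermitian_mat n A \<and>
     (\<forall>v \<in> carrier_vec n. v \<noteq> 0\<^sub>v n \<longrightarrow> Re ((A *\<^sub>v v) \<bullet>c v) > 0)}"

text \<open>Only meaningful for positive-definite arguments, which have exactly one
  positive-definite square root.\<close>

definition PD_sqrt :: "complex mat \<Rightarrow> complex mat" where
  "PD_sqrt Z = (THE S. S \<in> PD (dim_row Z) \<and> S * S = Z)"

text \<open>Total inverse; singular matrices are sent to the zero matrix.\<close>

definition mat_inv :: "complex mat \<Rightarrow> complex mat" where
  "mat_inv A = (case mat_inverse A of Some B \<Rightarrow> B | None \<Rightarrow> 0\<^sub>m (dim_row A) (dim_row A))"

text \<open>A completely positive map from \<open>p \<times> p\<close> to \<open>n \<times> n\<close> matrices is given by the list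
  of its Kraus operators \<open>A\<^sub>1, \<dots>, A\<^sub>r\<close>, which are \<open>n \<times> p\<close> matrices.\<close>

definition cp_map :: "nat \<Rightarrow> complex mat list \<Rightarrow> complex mat \<Rightarrow> complex mat" where
  "cp_map n As Y = foldr (+) (map (\<lambda>A. A * Y * mat_adjoint A) As) (0\<^sub>m n n)"

definition cp_dual :: "nat \<Rightarrow> complex mat list \<Rightarrow> complex mat \<Rightarrow> complex mat" where
  "cp_dual p As Y = foldr (+) (map (\<lambda>A. mat_adjoint A * Y * A) As) (0\<^sub>m p p)"

text \<open>The trace of \<open>\<Phi>(I\<^sub>p)\<close> is always real.\<close>

definition cp_size :: "nat \<Rightarrow> nat \<Rightarrow> complex mat list \<Rightarrow> real" where
  "cp_size n p As = Re (mat_trace (cp_map n As (1\<^sub>m p)))"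

definition quantum_expander :: "nat \<Rightarrow> nat \<Rightarrow> real \<Rightarrow> complex mat list \<Rightarrow> bool" where
  "quantum_expander n p \<epsilon> As \<longleftrightarrow>
     set As \<subseteq> carrier_mat n p \<and>
     cp_map n As (1\<^sub>m p) = complex_of_real (cp_size n p As / real n) \<cdot>\<^sub>m 1\<^sub>m n \<and>
     cp_dual p As (1\<^sub>m n) = complex_of_real (cp_size n p As / real p) \<cdot>\<^sub>m 1\<^sub>m p \<and>
     (\<forall>X. hermitian_mat p X \<and> mat_trace X = 0 \<longrightarrow>
        frobenius_norm (cp_map n As X)
          \<le> \<epsilon> * (cp_size n p As / sqrt (real n * real p)) * frobenius_norm X)"

text \<open>The geodesic gradient at \<open>Z\<close> of
  \<open>f\<^sup>\<Phi>(Z) = (p/n) log det \<Phi>(Z) - log det Z\<close> on the positive-definite matrices.\<close>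

definition geodesic_grad :: "nat \<Rightarrow> nat \<Rightarrow> complex mat list \<Rightarrow> complex mat \<Rightarrow> complex mat" where
  "geodesic_grad n p As Z =
     complex_of_real (real p / real n) \<cdot>\<^sub>m
       (PD_sqrt Z * cp_dual p As (mat_inv (cp_map n As Z)) * PD_sqrt Z) - 1\<^sub>m p"

primrec sinkhorn :: "nat \<Rightarrow> nat \<Rightarrow> complex mat list \<Rightarrow> complex mat \<Rightarrow> nat \<Rightarrow> complex mat" where
  "sinkhorn n p As Z\<^sub>0 0 = Z\<^sub>0"
| "sinkhorn n p As Z\<^sub>0 (Suc t) =
     mat_inv (complex_of_real (real p / real n) \<cdot>\<^sub>m
       cp_dual p As (mat_inv (cp_map n As (sinkhorn n p As Z\<^sub>0 t))))"

end

theory Submission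
  imports
    Defs
    "Jordan_Normal_Form.Spectral_Radius"
    "HOL-Analysis.L2_Norm"
begin

text \<open>
  One Sinkhorn step contracts the gradient by the factor \<open>1 - \<lambda>/4\<close> as long as its norm \<open>\<gamma>\<close> is at
  most \<open>\<lambda>\<^sup>2/64\<close>. Fix \<open>Z\<close> and pass to eigenbases of \<open>Z\<close> and of \<open>\<Phi>(Z)\<close>. The squared moduli of the
  entries of the Kraus operators then form a nonnegative matrix with constant row and column sums and a
  spectral gap, and scaling it by the eigenvalues \<open>z\<^sub>i\<close> of \<open>Z\<close> and \<open>w\<^sub>j\<close> of \<open>\<Phi>(Z)\<^sup>-\<^sup>1\<close> gives row
  sums that are exactly right and column sums that are off by the diagonal of the gradient. The
  symmetrised relative entropy of the two matrices is at most \<open>\<gamma> \<parallel>ln z\<parallel>\<close> up to a factor, whereas the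
  spectral gap bounds it from below by a multiple of \<open>\<lambda> \<parallel>ln z\<parallel>\<^sup>2\<close>. Hence, after rescaling, \<open>Z\<close> and
  \<open>\<Phi>(Z)\<close> are within \<open>O(\<gamma>/\<lambda>) = O(\<lambda>)\<close> of the identity, and the scaled map
  \<open>\<Psi>(X) = \<Phi>(Z)\<^sup>-\<^sup>1\<^sup>/\<^sup>2 \<Phi>(Z\<^sup>1\<^sup>/\<^sup>2 X Z\<^sup>1\<^sup>/\<^sup>2) \<Phi>(Z)\<^sup>-\<^sup>1\<^sup>/\<^sup>2\<close> is still a \<open>(1 - \<lambda>/2)\<close>-expander. To first order
  the new gradient is \<open>(p/n) \<Psi>\<^sup>*(\<Psi>(G))\<close> for the old gradient \<open>G\<close>, which has trace zero.
\<close>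

section \<open>Matrices and the Frobenius norm\<close>

text \<open>The obstacle is that \<open>Z\<close>, its image and the gradient need not be diagonal
  in one common basis. What helps is that the norm of the gradient does not change if the square
  root of \<open>Z\<close> is replaced by any factor \<open>L\<close> with
  \<open>L * L\<^sup>\<dagger> = Z\<close>, and that the image may likewise be normalised by any
  \<open>P\<close> for which \<open>P\<^sup>\<dagger> * P\<close> is the inverse of the image. Bases
  on both sides are thus free, and they are chosen twice: once to bound the spread of the
  eigenvalues of \<open>Z\<close>, where only the diagonal of the gradient enters, and once more to
  make the gradient and the image of the next iterate diagonal, where a step multiplies by
  \<open>1 / (1 + g i)\<close>. The threshold is quadratic because the gap is used twice: it turns
  the gradient norm into a distance at the price of 1/\<lambda>, and it survives a scaling only if
  that distance is a small multiple of \<lambda>. The constant 64 comes from the second use,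
  \<open>4 * \<gamma> / l \<le> l / 16\<close>.\<close>

notation mat_adjoint ("_\<^sup>\<dagger>" [1000] 1000)

lemma adjoint_dim [simp]: "dim_row (A\<^sup>\<dagger>) = dim_col A" "dim_col (A\<^sup>\<dagger>) = dim_row A"
  by (auto simp: mat_adjoint_def)

lemma adjoint_carrier [simp]: "A \<in> carrier_mat n m \<Longrightarrow> A\<^sup>\<dagger> \<in> carrier_mat m n"
  by (intro carrier_matI) auto

lemma adjoint_index [simp]:
  fixes A :: "complex mat"
  assumes "i < dim_col A" "j < dim_row A"
  shows "A\<^sup>\<dagger> $$ (i, j) = cnj (A $$ (j, i))"
  using assms by (simp add: mat_adjoint_def mat_of_rows_index)

lemma adjoint_adjoint [simp]: "(A\<^sup>\<dagger>)\<^sup>\<dagger> = (A :: complex mat)"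
  by (rule eq_matI) auto

lemma mult_index_sum:
  assumes "i < dim_row A" "j < dim_col B" "dim_col A = dim_row B"
  shows "(A * B) $$ (i, j) = (\<Sum>k<dim_row B. A $$ (i, k) * B $$ (k, j))"
  using assms by (simp add: scalar_prod_def atLeast0LessThan)

lemma adjoint_mult:
  fixes A B :: "complex mat"
  assumes "dim_col A = dim_row B"
  shows "(A * B)\<^sup>\<dagger> = B\<^sup>\<dagger> * A\<^sup>\<dagger>"
  by (rule eq_matI) (use assms in \<open>auto simp: mult_index_sum mult.commute simp del: index_mult_mat(1)\<close>)

lemma adjoint_one [simp]: "(1\<^sub>m n :: complex mat)\<^sup>\<dagger> = 1\<^sub>m n"
  by (rule eq_matI) auto

text \<open>Stated through \<open>dim_row\<close> and \<open>dim_col\<close>, whose values the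
  simplifier computes for nested products; membership in \<open>carrier_mat\<close> would leave the
  inner dimensions to be guessed.\<close>

lemma mult_assoc_dim:
  fixes A B C :: "complex mat"
  assumes "dim_col A = dim_row B" "dim_col B = dim_row C"
  shows "A * B * C = A * (B * C)"
  by (rule assoc_mult_mat) (use assms in auto)

text \<open>In a right-associated product an inverse pair stands as \<open>A * (B * C)\<close>, so
  together with \<open>mult_assoc_dim\<close> this cancels every inner pair.\<close>

lemma mult_cancel_dim:
  fixes A B C :: "complex mat"
  assumes "A * B = 1\<^sub>m k" "dim_col A = dim_row B" "dim_col B = dim_row C"
  shows "A * (B * C) = C"
proof -
  have "k = dim_col B" using assms(1) by (metis index_mult_mat(3) index_one_mat(3))
  then show ?thesis
    using assms mult_assoc_dim[of A B C] by (metis left_mult_one_mat')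
qed

lemma mult_one_dim [simp]:
  fixes A :: "complex mat"
  shows "dim_row A = k \<Longrightarrow> 1\<^sub>m k * A = A" "dim_col A = k \<Longrightarrow> A * 1\<^sub>m k = A"
  by auto

lemma mult_add_dim:
  fixes A B C :: "complex mat"
  assumes "dim_col A = dim_row B" "dim_row C = dim_row B" "dim_col C = dim_col B"
  shows "A * (B + C) = A * B + A * C"
  by (rule mult_add_distrib_mat) (use assms in auto)

lemma add_mult_dim:
  fixes A B C :: "complex mat"
  assumes "dim_col B = dim_row A" "dim_row C = dim_row B" "dim_col C = dim_col B"
  shows "(B + C) * A = B * A + C * A"
  by (rule add_mult_distrib_mat) (use assms in auto)

lemma smult_mult_dim:
  fixes A B :: "complex mat"
  assumes "dim_col A = dim_row B"
  shows "(c \<cdot>\<^sub>m A) * B = c \<cdot>\<^sub>m (A * B)"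
  by (rule mult_smult_assoc_mat) (use assms in auto)

lemma mult_smult_dim:
  fixes A B :: "complex mat"
  assumes "dim_col A = dim_row B"
  shows "A * (c \<cdot>\<^sub>m B) = c \<cdot>\<^sub>m (A * B)"
  by (rule mult_smult_distrib) (use assms in auto)

lemma smult_smult_mat: "a \<cdot>\<^sub>m (b \<cdot>\<^sub>m A) = (a * b :: complex) \<cdot>\<^sub>m A"
  by (rule eq_matI) auto

section \<open>Real diagonal matrices\<close>

definition rdiag :: "nat \<Rightarrow> (nat \<Rightarrow> real) \<Rightarrow> complex mat" where
  "rdiag n d = mat n n (\<lambda>(i, j). if i = j then complex_of_real (d i) else 0)"

lemma rdiag_dim [simp]: "dim_row (rdiag n d) = n" "dim_col (rdiag n d) = n"
  by (auto simp: rdiag_def)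

lemma rdiag_carrier [simp]: "rdiag n d \<in> carrier_mat n n"
  by (intro carrier_matI) auto

lemma rdiag_index [simp]:
  "i < n \<Longrightarrow> j < n \<Longrightarrow> rdiag n d $$ (i, j) = (if i = j then complex_of_real (d i) else 0)"
  by (simp add: rdiag_def)

lemma rdiag_cong: "(\<And>i. i < n \<Longrightarrow> a i = b i) \<Longrightarrow> rdiag n a = rdiag n b"
  by (rule eq_matI) auto

lemma rdiag_adjoint [simp]: "(rdiag n d)\<^sup>\<dagger> = rdiag n d"
  by (rule eq_matI) auto

lemma rdiag_mult_index [simp]:
  assumes "i < n" "j < dim_col A" "dim_row A = n"
  shows "(rdiag n d * A) $$ (i, j) = complex_of_real (d i) * A $$ (i, j)"
proof -
  have "(rdiag n d * A) $$ (i, j) = (\<Sum>k<n. rdiag n d $$ (i, k) * A $$ (k, j))"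
    using assms by (subst mult_index_sum) auto
  also have "\<dots> = (\<Sum>k<n. if k = i then complex_of_real (d i) * A $$ (i, j) else 0)"
    using assms by (intro sum.cong) auto
  also have "\<dots> = complex_of_real (d i) * A $$ (i, j)"
    using assms by simp
  finally show ?thesis .
qed

lemma mult_rdiag_index [simp]:
  assumes "i < dim_row A" "j < n" "dim_col A = n"
  shows "(A * rdiag n d) $$ (i, j) = A $$ (i, j) * complex_of_real (d j)"
proof -
  have "(A * rdiag n d) $$ (i, j) = (\<Sum>k<n. A $$ (i, k) * rdiag n d $$ (k, j))"
    using assms by (subst mult_index_sum) auto
  also have "\<dots> = (\<Sum>k<n. if k = j then A $$ (i, j) * complex_of_real (d j) else 0)"
    using assms by (intro sum.cong) auto
  also have "\<dots> = A $$ (i, j) * complex_of_real (d j)"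
    using assms by simp
  finally show ?thesis .
qed

lemma rdiag_mult: "rdiag n a * rdiag n b = rdiag n (\<lambda>i. a i * b i)"
  by (rule eq_matI) (auto simp del: index_mult_mat(1))

lemma rdiag_one: "rdiag n (\<lambda>_. 1) = 1\<^sub>m n"
  by (rule eq_matI) auto

lemma rdiag_inverse:
  assumes "\<And>i. i < n \<Longrightarrow> a i * b i = 1"
  shows "rdiag n a * rdiag n b = 1\<^sub>m n"
  unfolding rdiag_mult rdiag_one[symmetric] by (rule rdiag_cong) (use assms in auto)

section \<open>Invariance and estimates of the Frobenius norm; the trace\<close>

lemma frobenius_norm_nonneg [simp]: "0 \<le> frobenius_norm A"
  by (simp add: frobenius_norm_def sum_nonneg)

lemma frobenius_norm_sq:
  "(frobenius_norm A)\<^sup>2 = (\<Sum>i<dim_row A. \<Sum>j<dim_col A. (cmod (A $$ (i, j)))\<^sup>2)"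
  by (simp add: frobenius_norm_def sum_nonneg)

lemma frobenius_norm_L2_set:
  "frobenius_norm A = L2_set (\<lambda>x. cmod (A $$ x)) ({..<dim_row A} \<times> {..<dim_col A})"
  by (simp add: frobenius_norm_def L2_set_def sum.cartesian_product)

lemma adjoint_mult_self_index:
  fixes A :: "complex mat"
  assumes "j < dim_col A"
  shows "(A\<^sup>\<dagger> * A) $$ (j, j) = complex_of_real (\<Sum>i<dim_row A. (cmod (A $$ (i, j)))\<^sup>2)"
  using assms
  by (auto simp: mult_index_sum complex_norm_square mult.commute simp del: index_mult_mat(1) of_real_power intro!: sum.cong)

text \<open>In this form invariance under isometries is a cancellation of
  \<open>U\<^sup>\<dagger> * U\<close>.\<close>

lemma frobenius_norm_trace:
  "complex_of_real ((frobenius_norm A)\<^sup>2) = mat_trace (A\<^sup>\<dagger> * A)"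
proof -
  have "(frobenius_norm A)\<^sup>2 = (\<Sum>j<dim_col A. \<Sum>i<dim_row A. (cmod (A $$ (i, j)))\<^sup>2)"
    unfolding frobenius_norm_sq by (rule sum.swap)
  then show ?thesis
    by (simp add: mat_trace_def adjoint_mult_self_index del: index_mult_mat(1) of_real_power)
qed

lemma frobenius_norm_isometry_left:
  assumes "U\<^sup>\<dagger> * U = 1\<^sub>m (dim_row A)" "dim_col U = dim_row A"
  shows "frobenius_norm (U * A) = frobenius_norm A"
proof -
  have "(U * A)\<^sup>\<dagger> * (U * A) = A\<^sup>\<dagger> * A"
    using assms by (simp add: adjoint_mult mult_assoc_dim mult_cancel_dim)
  then have "(frobenius_norm (U * A))\<^sup>2 = (frobenius_norm A)\<^sup>2"
    by (metis frobenius_norm_trace of_real_eq_iff)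
  then show ?thesis by simp
qed

lemma frobenius_norm_adjoint [simp]: "frobenius_norm (A\<^sup>\<dagger>) = frobenius_norm A"
  unfolding frobenius_norm_def
  by (subst sum.swap) (auto intro!: sum.cong)

lemma frobenius_norm_isometry_right:
  assumes "U * U\<^sup>\<dagger> = 1\<^sub>m (dim_col A)" "dim_row U = dim_col A"
  shows "frobenius_norm (A * U) = frobenius_norm A"
proof -
  have "frobenius_norm (U\<^sup>\<dagger> * A\<^sup>\<dagger>) = frobenius_norm (A\<^sup>\<dagger>)"
    by (rule frobenius_norm_isometry_left) (use assms in auto)
  then show ?thesis
    using assms by (simp flip: adjoint_mult)
qed

lemma frobenius_norm_unitary_conjugate:
  assumes "U \<in> carrier_mat n n" "U\<^sup>\<dagger> * U = 1\<^sub>m n" "X \<in> carrier_mat n n"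
  shows "frobenius_norm (U * X * U\<^sup>\<dagger>) = frobenius_norm X"
proof -
  have "frobenius_norm (U * X * U\<^sup>\<dagger>) = frobenius_norm (U * X)"
    by (rule frobenius_norm_isometry_right) (use assms in auto)
  also have "\<dots> = frobenius_norm X"
    by (rule frobenius_norm_isometry_left) (use assms in auto)
  finally show ?thesis .
qed

lemma frobenius_norm_triangle:
  assumes "A \<in> carrier_mat n m" "B \<in> carrier_mat n m"
  shows "frobenius_norm (A + B) \<le> frobenius_norm A + frobenius_norm B"
proof -
  let ?S = "{..<n} \<times> {..<m}"
  have "frobenius_norm (A + B) \<le> L2_set (\<lambda>x. cmod (A $$ x) + cmod (B $$ x)) ?S"
    unfolding frobenius_norm_L2_set using assms
    by (auto intro!: L2_set_mono norm_triangle_ineq)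
  also have "\<dots> \<le> L2_set (\<lambda>x. cmod (A $$ x)) ?S + L2_set (\<lambda>x. cmod (B $$ x)) ?S"
    by (rule L2_set_triangle_ineq)
  finally show ?thesis
    unfolding frobenius_norm_L2_set using assms by auto
qed

text \<open>Serves for two-sided diagonal scalings, which multiply each entry by a bounded
  factor.\<close>

lemma frobenius_norm_le_scale:
  assumes "dim_row A = dim_row B" "dim_col A = dim_col B" "0 \<le> c"
    and "\<And>i j. i < dim_row B \<Longrightarrow> j < dim_col B \<Longrightarrow> cmod (A $$ (i, j)) \<le> c * cmod (B $$ (i, j))"
  shows "frobenius_norm A \<le> c * frobenius_norm B"
proof -
  have "frobenius_norm A \<le> L2_set (\<lambda>x. c * cmod (B $$ x)) ({..<dim_row B} \<times> {..<dim_col B})"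
    unfolding frobenius_norm_L2_set using assms by (auto intro!: L2_set_mono)
  also have "\<dots> = c * frobenius_norm B"
    unfolding frobenius_norm_L2_set using assms by (simp add: L2_set_right_distrib)
  finally show ?thesis .
qed

lemma frobenius_norm_smult:
  "frobenius_norm (complex_of_real c \<cdot>\<^sub>m A) = \<bar>c\<bar> * frobenius_norm A"
proof -
  have "(frobenius_norm (complex_of_real c \<cdot>\<^sub>m A))\<^sup>2 = (\<bar>c\<bar> * frobenius_norm A)\<^sup>2"
    by (simp add: frobenius_norm_sq power_mult_distrib norm_mult sum_distrib_left)
  then show ?thesis
    by (metis abs_ge_zero frobenius_norm_nonneg power2_eq_imp_eq zero_le_mult_iff)
qed

lemma frobenius_norm_diag_le:
  assumes "A \<in> carrier_mat n n"
  shows "(\<Sum>i<n. (cmod (A $$ (i, i)))\<^sup>2) \<le> (frobenius_norm A)\<^sup>2"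
proof -
  have "(cmod (A $$ (i, i)))\<^sup>2 \<le> (\<Sum>j<n. (cmod (A $$ (i, j)))\<^sup>2)"
    if "i < n" for i
    using that by (intro member_le_sum) auto
  then show ?thesis
    using assms by (auto simp: frobenius_norm_sq intro!: sum_mono)
qed

lemma frobenius_norm_rdiag: "(frobenius_norm (rdiag n d))\<^sup>2 = (\<Sum>i<n. (d i)\<^sup>2)"
proof -
  have "(\<Sum>j<n. (cmod (rdiag n d $$ (i, j)))\<^sup>2) = (d i)\<^sup>2" if "i < n" for i
  proof -
    have "(\<Sum>j<n. (cmod (rdiag n d $$ (i, j)))\<^sup>2) = (\<Sum>j<n. if j = i then (d i)\<^sup>2 else 0)"
      using that by (intro sum.cong) auto
    then show ?thesis using that by simp
  qed
  then show ?thesis by (simp add: frobenius_norm_sq)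
qed

lemma mat_trace_mult_comm:
  assumes "A \<in> carrier_mat n m" "B \<in> carrier_mat m n"
  shows "mat_trace (A * B) = mat_trace (B * A)"
proof -
  have "mat_trace (A * B) = (\<Sum>i<n. \<Sum>k<m. A $$ (i, k) * B $$ (k, i))"
    using assms by (simp add: mat_trace_def mult_index_sum del: index_mult_mat(1))
  also have "\<dots> = (\<Sum>k<m. \<Sum>i<n. B $$ (k, i) * A $$ (i, k))"
    by (subst sum.swap) (simp add: mult.commute)
  also have "\<dots> = mat_trace (B * A)"
    using assms by (simp add: mat_trace_def mult_index_sum del: index_mult_mat(1))
  finally show ?thesis .
qed

lemma mat_trace_unitary_conjugate:
  assumes "U \<in> carrier_mat n n" "U\<^sup>\<dagger> * U = 1\<^sub>m n" "X \<in> carrier_mat n n"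
  shows "mat_trace (U * X * U\<^sup>\<dagger>) = mat_trace X"
proof -
  have "mat_trace (U * X * U\<^sup>\<dagger>) = mat_trace (U\<^sup>\<dagger> * (U * X))"
    by (rule mat_trace_mult_comm[of _ n n]) (use assms in auto)
  then show ?thesis using assms by (simp add: mult_cancel_dim)
qed

lemma hermitian_conjugate:
  assumes "hermitian_mat n X" "U \<in> carrier_mat n n"
  shows "hermitian_mat n (U * X * U\<^sup>\<dagger>)"
  using assms by (auto simp: hermitian_mat_def adjoint_mult mult_assoc_dim)

lemma hermitian_rdiag [simp]: "hermitian_mat n (rdiag n d)"
  by (simp add: hermitian_mat_def)

section \<open>The spectral theorem and positive-definite matrices\<close>

text \<open>Gram-Schmidt keeps the first vector of a basis that starts with \<open>v\<close>. Its
  output is orthogonal but not normalised, so the columns are divided by their lengths;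
  \<open>c\<close> is the inverse length of \<open>v\<close>.\<close>

lemma unitary_with_first_column:
  fixes v :: "complex vec"
  assumes v: "v \<in> carrier_vec m" and v0: "v \<noteq> 0\<^sub>v m"
  obtains W c where "W \<in> carrier_mat m m" "W\<^sup>\<dagger> * W = 1\<^sub>m m"
    "\<And>i. i < m \<Longrightarrow> W $$ (i, 0) = c * v $ i"
proof -
  interpret cof_vec_space m "TYPE(complex)" .
  note bc = basis_completion[OF v v0]
  define ws where "ws = gram_schmidt m (basis_completion v)"
  note gs = gram_schmidt_result[OF bc(2) bc(4) bc(5) ws_def]
  have len: "length ws = m" using gs(4) bc(6) by simp
  have m: "0 < m" using v v0 by (cases m) auto
  obtain bs where bs: "basis_completion v = v # bs"
    using bc(6,7) m by (cases "basis_completion v") auto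
  have ws0: "ws ! 0 = v"
    using len m gram_schmidt_hd[OF v, of bs] unfolding ws_def bs
    by (metis hd_conv_nth length_0_conv less_numeral_extra(3))
  have wsc: "ws ! j \<in> carrier_vec m" if "j < m" for j
    using gs(3) len that by auto
  define N where "N j = (\<Sum>k<m. (cmod (ws ! j $ k))\<^sup>2)" for j
  have sp: "ws ! j \<bullet>c ws ! i = (\<Sum>k<m. ws ! j $ k * cnj (ws ! i $ k))"
    if "i < m" "j < m" for i j
    using wsc[OF that(1)] wsc[OF that(2)] by (simp add: scalar_prod_def atLeast0LessThan)
  have self: "ws ! j \<bullet>c ws ! j = complex_of_real (N j)" if "j < m" for j
    using sp[OF that that] by (simp add: N_def complex_norm_square del: of_real_power)
  have N0: "N j > 0" if "j < m" for j
  proof -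
    have "N j \<noteq> 0" using self[OF that] gs(2) len that unfolding corthogonal_def by auto
    moreover have "N j \<ge> 0" by (simp add: N_def sum_nonneg)
    ultimately show ?thesis by simp
  qed
  define W where "W = mat m m (\<lambda>(i, j). ws ! j $ i / complex_of_real (sqrt (N j)))"
  have "W\<^sup>\<dagger> * W = 1\<^sub>m m"
  proof (rule eq_matI)
    fix i j assume "i < dim_row (1\<^sub>m m :: complex mat)" "j < dim_col (1\<^sub>m m :: complex mat)"
    then have ij: "i < m" "j < m" by auto
    then have "(W\<^sup>\<dagger> * W) $$ (i, j) =
        (\<Sum>k<m. (ws ! j $ k * cnj (ws ! i $ k)) / (complex_of_real (sqrt (N i)) * complex_of_real (sqrt (N j))))"
      by (subst mult_index_sum) (auto simp: W_def intro!: sum.cong)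
    also have "\<dots> = (ws ! j \<bullet>c ws ! i) / (complex_of_real (sqrt (N i)) * complex_of_real (sqrt (N j)))"
      using sp[OF ij] by (simp add: sum_divide_distrib)
    also have "\<dots> = (if i = j then 1 else 0)"
    proof (cases "i = j")
      case True
      have "complex_of_real (sqrt (N j)) * complex_of_real (sqrt (N j)) = complex_of_real (N j)"
        using N0[OF ij(2)] by (simp flip: of_real_mult)
      then show ?thesis using self[OF ij(2)] N0[OF ij(2)] True by simp
    next
      case False
      then show ?thesis using gs(2) len ij unfolding corthogonal_def by auto
    qed
    finally show "(W\<^sup>\<dagger> * W) $$ (i, j) = 1\<^sub>m m $$ (i, j)" using ij by simp
  qed (auto simp: W_def)
  moreover have "W $$ (i, 0) = inverse (complex_of_real (sqrt (N 0))) * v $ i" if "i < m" for i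
    using that m by (simp add: W_def ws0 field_simps)
  ultimately show ?thesis using that[of W] by (auto simp: W_def)
qed

text \<open>Deflation: in a unitary basis that starts with an eigenvector of \<open>A\<close> the
  first column of \<open>B\<close> is a multiple of the first unit vector. As \<open>B\<close> is
  Hermitian, so is its first row, and the remaining block is a Hermitian matrix of size
  \<open>n\<close>.\<close>

lemma hermitian_spectral:
  assumes "hermitian_mat n A"
  shows "\<exists>U d. U \<in> carrier_mat n n \<and> U\<^sup>\<dagger> * U = 1\<^sub>m n \<and> A = U * rdiag n d * U\<^sup>\<dagger>"
  using assms
proof (induction n arbitrary: A)
  case 0
  then have "A \<in> carrier_mat 0 0" by (simp add: hermitian_mat_def)
  then have "A = 1\<^sub>m 0 * rdiag 0 (\<lambda>_. 0) * (1\<^sub>m 0)\<^sup>\<dagger>"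
    by (intro eq_matI) auto
  then show ?case
    by (metis adjoint_one one_carrier_mat left_mult_one_mat)
next
  case (Suc n)
  let ?m = "Suc n"
  have A: "A \<in> carrier_mat ?m ?m" and Aadj: "A\<^sup>\<dagger> = A"
    using Suc.prems by (auto simp: hermitian_mat_def)
  from spectrum_non_empty[OF A] obtain e where "eigenvalue A e"
    by (auto simp: spectrum_def)
  then obtain v where v: "v \<in> carrier_vec ?m" "v \<noteq> 0\<^sub>v ?m" "A *\<^sub>v v = e \<cdot>\<^sub>v v"
    using A by (auto simp: eigenvalue_def eigenvector_def)
  obtain W c where W: "W \<in> carrier_mat ?m ?m" "W\<^sup>\<dagger> * W = 1\<^sub>m ?m"
      "\<And>i. i < ?m \<Longrightarrow> W $$ (i, 0) = c * v $ i"
    using unitary_with_first_column[OF v(1,2)] by blast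
  have WW: "W * W\<^sup>\<dagger> = 1\<^sub>m ?m"
    using mat_mult_left_right_inverse[OF _ W(1) W(2)] W(1) by simp
  have dims: "dim_row A = ?m" "dim_col A = ?m" "dim_row W = ?m" "dim_col W = ?m"
    using A W(1) by auto
  define B where "B = W\<^sup>\<dagger> * A * W"
  have Bdim: "dim_row B = ?m" "dim_col B = ?m" using dims by (auto simp: B_def)
  have Badj: "B\<^sup>\<dagger> = B"
    using dims Aadj by (simp add: B_def adjoint_mult mult_assoc_dim)
  have Bsym: "B $$ (j, i) = cnj (B $$ (i, j))" if "i < ?m" "j < ?m" for i j
    using adjoint_index[of j B i] that Bdim Badj by simp
  have AW: "(A * W) $$ (i, 0) = e * W $$ (i, 0)" if "i < ?m" for i
  proof -
    have "(A * W) $$ (i, 0) = c * (\<Sum>k<?m. A $$ (i, k) * v $ k)"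
      using that dims W(3)
      by (subst mult_index_sum) (auto simp: sum_distrib_left simp del: sum.lessThan_Suc intro!: sum.cong)
    also have "(\<Sum>k<?m. A $$ (i, k) * v $ k) = (A *\<^sub>v v) $ i"
      using that dims v(1) by (simp add: scalar_prod_def atLeast0LessThan del: sum.lessThan_Suc)
    also have "\<dots> = e * v $ i" using that v by simp
    finally show ?thesis using W(3)[OF that] by simp
  qed
  have B0: "B $$ (i, 0) = (if i = 0 then e else 0)" if "i < ?m" for i
  proof -
    have "B $$ (i, 0) = (W\<^sup>\<dagger> * (A * W)) $$ (i, 0)"
      using dims by (simp add: B_def mult_assoc_dim)
    also have "\<dots> = (\<Sum>k<?m. W\<^sup>\<dagger> $$ (i, k) * (e * W $$ (k, 0)))"
      using that dims AW
      by (subst mult_index_sum) (auto simp del: sum.lessThan_Suc index_mult_mat(1) intro!: sum.cong)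
    also have "\<dots> = e * (\<Sum>k<?m. W\<^sup>\<dagger> $$ (i, k) * W $$ (k, 0))"
      by (simp add: sum_distrib_left algebra_simps del: sum.lessThan_Suc)
    also have "(\<Sum>k<?m. W\<^sup>\<dagger> $$ (i, k) * W $$ (k, 0)) = (W\<^sup>\<dagger> * W) $$ (i, 0)"
      using that dims by (subst mult_index_sum) (auto simp del: sum.lessThan_Suc)
    finally show ?thesis using that W(2) by simp
  qed
  \<comment> \<open>\<open>e\<close> stands on the diagonal of the Hermitian \<open>B\<close>, hence
    is real, as \<open>rdiag\<close> requires.\<close>
  have er: "complex_of_real (Re e) = e"
    using Bsym[of 0 0] B0[of 0] by (simp add: complex_eq_iff)
  define B2 where "B2 = mat n n (\<lambda>(i, j). B $$ (Suc i, Suc j))"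
  have "hermitian_mat n B2"
  proof -
    have "B2\<^sup>\<dagger> = B2"
    proof (rule eq_matI)
      fix i j assume "i < dim_row B2" "j < dim_col B2"
      then show "B2\<^sup>\<dagger> $$ (i, j) = B2 $$ (i, j)"
        using Bsym[of "Suc j" "Suc i"] by (simp add: B2_def)
    qed (auto simp: B2_def)
    then show ?thesis by (simp add: hermitian_mat_def) (simp add: B2_def)
  qed
  then obtain U2 d2 where U2: "U2 \<in> carrier_mat n n" "U2\<^sup>\<dagger> * U2 = 1\<^sub>m n" "B2 = U2 * rdiag n d2 * U2\<^sup>\<dagger>"
    using Suc.IH by blast
  \<comment> \<open>Direct sum of the 1 x 1 identity and \<open>U2\<close>, so that the eigenvector
    direction stays fixed.\<close>
  define U3 where "U3 = mat ?m ?m (\<lambda>(i, j). if i = 0 \<and> j = 0 then 1 else if i = 0 \<or> j = 0 then 0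
      else U2 $$ (i - 1, j - 1))"
  define d where "d = case_nat (Re e) d2"
  have U3dim: "dim_row U3 = ?m" "dim_col U3 = ?m" by (auto simp: U3_def)
  have "U3\<^sup>\<dagger> * U3 = 1\<^sub>m ?m"
  proof (rule eq_matI)
    fix i j assume "i < dim_row (1\<^sub>m ?m :: complex mat)" "j < dim_col (1\<^sub>m ?m :: complex mat)"
    then have ij: "i < ?m" "j < ?m" by auto
    have u: "(\<Sum>k<n. cnj (U2 $$ (k, a)) * U2 $$ (k, b)) = (if a = b then 1 else 0)"
      if "a < n" "b < n" for a b
    proof -
      have "(\<Sum>k<n. cnj (U2 $$ (k, a)) * U2 $$ (k, b)) = (U2\<^sup>\<dagger> * U2) $$ (a, b)"
        using U2(1) that by (subst mult_index_sum) auto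
      then show ?thesis using U2(2) that by simp
    qed
    show "(U3\<^sup>\<dagger> * U3) $$ (i, j) = 1\<^sub>m ?m $$ (i, j)"
      using ij u by (subst mult_index_sum, simp_all add: U3dim del: sum.lessThan_Suc)
        (cases i; cases j; simp add: U3_def sum.lessThan_Suc_shift del: sum.lessThan_Suc)
  qed (auto simp: U3dim)
  moreover have "B = U3 * rdiag ?m d * U3\<^sup>\<dagger>"
  proof (rule eq_matI)
    fix i j assume "i < dim_row (U3 * rdiag ?m d * U3\<^sup>\<dagger>)" "j < dim_col (U3 * rdiag ?m d * U3\<^sup>\<dagger>)"
    then have ij: "i < ?m" "j < ?m" by (auto simp: U3dim)
    have u: "(\<Sum>k<n. U2 $$ (a, k) * complex_of_real (d2 k) * cnj (U2 $$ (b, k))) = B $$ (Suc a, Suc b)"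
      if "a < n" "b < n" for a b
    proof -
      have "(\<Sum>k<n. U2 $$ (a, k) * complex_of_real (d2 k) * cnj (U2 $$ (b, k))) = (U2 * rdiag n d2 * U2\<^sup>\<dagger>) $$ (a, b)"
        using U2(1) that by (subst mult_index_sum) (auto simp del: index_mult_mat(1))
      also have "\<dots> = B2 $$ (a, b)" by (simp only: U2(3))
      finally show ?thesis using that by (simp add: B2_def)
    qed
    have B0': "B $$ (0, j) = (if j = 0 then e else 0)" if "j < ?m" for j
      using Bsym[of j 0] B0[of j] that er by (auto simp: complex_eq_iff)
    show "B $$ (i, j) = (U3 * rdiag ?m d * U3\<^sup>\<dagger>) $$ (i, j)"
      using ij u B0 B0' er
      by (subst mult_index_sum, simp_all add: U3dim del: sum.lessThan_Suc index_mult_mat(1))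
        (cases i; cases j; simp add: U3_def d_def sum.lessThan_Suc_shift del: sum.lessThan_Suc)
  qed (auto simp: Bdim U3dim)
  moreover have "A = W * B * W\<^sup>\<dagger>"
    using dims WW by (simp add: B_def mult_assoc_dim mult_cancel_dim)
  ultimately have "(W * U3)\<^sup>\<dagger> * (W * U3) = 1\<^sub>m ?m" "A = (W * U3) * rdiag ?m d * (W * U3)\<^sup>\<dagger>"
    using dims U3dim W(2) by (simp_all add: adjoint_mult mult_assoc_dim mult_cancel_dim)
  moreover have "W * U3 \<in> carrier_mat ?m ?m" using dims U3dim by (intro carrier_matI) auto
  ultimately show ?case by blast
qed

section \<open>Evaluating the total inverse\<close>

lemma mat_inv_carrier [simp]:
  assumes "A \<in> carrier_mat n n"
  shows "mat_inv A \<in> carrier_mat n n"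
proof (cases "mat_inverse A")
  case None
  then show ?thesis using assms by (auto simp: mat_inv_def)
next
  case (Some B)
  then show ?thesis using mat_inverse(2)[OF assms Some] by (simp add: mat_inv_def)
qed

text \<open>A one-sided inverse of a square matrix is two-sided, so \<open>A\<close> is a unit of
  the matrix ring and \<open>mat_inverse\<close> is not in its \<open>None\<close> case; uniqueness
  of inverses does the rest.\<close>

lemma mat_inv_eqI:
  assumes A: "A \<in> carrier_mat n n" and B: "B \<in> carrier_mat n n" and AB: "A * B = 1\<^sub>m n"
  shows "mat_inv A = B"
proof -
  have BA: "B * A = 1\<^sub>m n" using mat_mult_left_right_inverse[OF A B AB] .
  have "A \<in> Units (ring_mat TYPE(complex) n n)"
    using A B AB BA by (auto simp: Units_def ring_mat_def)
  then obtain C where C: "mat_inverse A = Some C"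
    using mat_inverse(1)[OF A, of n] by (cases "mat_inverse A") auto
  then have "A * C = 1\<^sub>m n" "C \<in> carrier_mat n n" using mat_inverse(2)[OF A C] by auto
  then have "C = B"
    using mult_cancel_dim[OF BA, of C] A B by simp
  then show ?thesis using C by (simp add: mat_inv_def)
qed

section \<open>Gram matrices, positive eigenvalues and square roots\<close>

lemma cscalar_prod_mult_mat_vec:
  fixes A :: "complex mat"
  assumes "A \<in> carrier_mat n m" "w \<in> carrier_vec m" "v \<in> carrier_vec n"
  shows "(A *\<^sub>v w) \<bullet>c v = w \<bullet>c (A\<^sup>\<dagger> *\<^sub>v v)"
proof -
  have "(A *\<^sub>v w) \<bullet>c v = (\<Sum>i<n. \<Sum>k<m. A $$ (i, k) * w $ k * cnj (v $ i))"
    using assms by (auto simp: scalar_prod_def atLeast0LessThan sum_distrib_right)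
  also have "\<dots> = (\<Sum>k<m. \<Sum>i<n. A $$ (i, k) * w $ k * cnj (v $ i))" by (rule sum.swap)
  also have "\<dots> = w \<bullet>c (A\<^sup>\<dagger> *\<^sub>v v)"
    using assms
    by (auto simp: scalar_prod_def atLeast0LessThan sum_distrib_left mult_ac intro!: sum.cong)
  finally show ?thesis .
qed

lemma cscalar_prod_self_pos:
  fixes w :: "complex vec"
  assumes "w \<in> carrier_vec n" "w \<noteq> 0\<^sub>v n"
  shows "Re (w \<bullet>c w) > 0"
proof -
  have e: "w \<bullet>c w = complex_of_real (\<Sum>k<n. (cmod (w $ k))\<^sup>2)"
    using assms(1)
    by (simp add: scalar_prod_def atLeast0LessThan complex_norm_square del: of_real_power)
  have "w \<bullet>c w \<noteq> 0" using conjugate_square_eq_0_vec[OF assms(1)] assms(2) by simp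
  then have "(\<Sum>k<n. (cmod (w $ k))\<^sup>2) \<noteq> 0" using e by (metis of_real_0)
  moreover have "(\<Sum>k<n. (cmod (w $ k))\<^sup>2) \<ge> 0" by (simp add: sum_nonneg)
  ultimately show ?thesis using e by (simp del: of_real_power)
qed

text \<open>The quadratic form at \<open>v\<close> is the squared norm of
  \<open>L\<^sup>\<dagger> *\<^sub>v v\<close>, and \<open>K\<^sup>\<dagger>\<close> recovers
  \<open>v\<close> from that vector, which therefore does not vanish.\<close>

lemma PD_gram:
  assumes L: "L \<in> carrier_mat n n" and K: "K \<in> carrier_mat n n" and LK: "L * K = 1\<^sub>m n"
  shows "L * L\<^sup>\<dagger> \<in> PD n"
proof -
  have "Re ((L * L\<^sup>\<dagger> *\<^sub>v v) \<bullet>c v) > 0"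
    if v: "v \<in> carrier_vec n" "v \<noteq> 0\<^sub>v n" for v
  proof -
    let ?w = "L\<^sup>\<dagger> *\<^sub>v v"
    have w: "?w \<in> carrier_vec n" using L v by (simp add: mult_mat_vec_carrier[of _ n n])
    have "K\<^sup>\<dagger> * L\<^sup>\<dagger> = 1\<^sub>m n"
      using LK L K by (metis adjoint_mult adjoint_one carrier_matD)
    then have "K\<^sup>\<dagger> *\<^sub>v ?w = v"
      using L K v by (simp flip: assoc_mult_mat_vec[of _ n n _ n])
    moreover have "K\<^sup>\<dagger> *\<^sub>v 0\<^sub>v n = 0\<^sub>v n"
      using K by (intro eq_vecI) auto
    ultimately have "?w \<noteq> 0\<^sub>v n" using v by auto
    moreover have "(L * L\<^sup>\<dagger> *\<^sub>v v) \<bullet>c v = ?w \<bullet>c ?w"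
      using L v w cscalar_prod_mult_mat_vec[OF L w v(1)]
      by (simp add: assoc_mult_mat_vec[of _ n n _ n])
    ultimately show ?thesis using cscalar_prod_self_pos[OF w] by simp
  qed
  moreover have "hermitian_mat n (L * L\<^sup>\<dagger>)"
    using L by (auto simp: hermitian_mat_def adjoint_mult)
  ultimately show ?thesis by (simp add: PD_def)
qed

text \<open>Each eigenvalue is the value of the quadratic form at the corresponding column of
  \<open>U\<close>.\<close>

lemma PD_spectral:
  assumes Z: "Z \<in> PD n"
  obtains U z where "U \<in> carrier_mat n n" "U\<^sup>\<dagger> * U = 1\<^sub>m n" "\<And>i. i < n \<Longrightarrow> 0 < z i"
    "Z = U * rdiag n z * U\<^sup>\<dagger>"
proof -
  have h: "hermitian_mat n Z" and Zc: "Z \<in> carrier_mat n n"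
    using Z by (auto simp: PD_def hermitian_mat_def)
  obtain U z where U: "U \<in> carrier_mat n n" "U\<^sup>\<dagger> * U = 1\<^sub>m n" and Ze: "Z = U * rdiag n z * U\<^sup>\<dagger>"
    using hermitian_spectral[OF h] by blast
  have ZU: "Z * U = U * rdiag n z"
    using U by (simp add: Ze mult_assoc_dim)
  have "0 < z i" if i: "i < n" for i
  proof -
    have one: "(\<Sum>k<n. U $$ (k, i) * cnj (U $$ (k, i))) = 1"
    proof -
      have "(\<Sum>k<n. U $$ (k, i) * cnj (U $$ (k, i))) = (U\<^sup>\<dagger> * U) $$ (i, i)"
        using U(1) i by (subst mult_index_sum) (auto intro!: sum.cong)
      then show ?thesis using U(2) i by simp
    qed
    have c: "col U i \<in> carrier_vec n" using U(1) i by auto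
    have "col U i \<noteq> 0\<^sub>v n"
    proof
      assume "col U i = 0\<^sub>v n"
      then have "U $$ (k, i) = 0" if "k < n" for k
        using that i U(1) by (metis carrier_matD(1,2) index_col index_zero_vec(1))
      then show False using one by simp
    qed
    then have "Re ((Z *\<^sub>v col U i) \<bullet>c col U i) > 0" using Z c by (simp add: PD_def)
    moreover have "Z *\<^sub>v col U i = col (Z * U) i"
      using U(1) Zc i by (intro eq_vecI) auto
    moreover have "col (Z * U) i \<bullet>c col U i = complex_of_real (z i)"
    proof -
      have "col (Z * U) i \<bullet>c col U i = (\<Sum>k<n. complex_of_real (z i) * (U $$ (k, i) * cnj (U $$ (k, i))))"
        using U(1) i unfolding ZU
        by (auto simp: scalar_prod_def atLeast0LessThan mult_ac simp del: index_mult_mat(1) col_mult2 intro!: sum.cong)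
      also have "\<dots> = complex_of_real (z i)" by (simp add: one flip: sum_distrib_left)
      finally show ?thesis .
    qed
    ultimately show ?thesis by simp
  qed
  then show ?thesis using that U Ze by blast
qed

text \<open>The transition matrix \<open>W\<close> between the eigenbases intertwines the squared
  eigenvalues. Entrywise, \<open>W $$ (i, j)\<close> vanishes unless \<open>t i\<close> and
  \<open>s j\<close> have equal squares; both are positive, so then they are equal, and
  \<open>W\<close> intertwines the eigenvalues themselves.\<close>

lemma PD_sqrt_unique:
  assumes S: "S \<in> PD n" and T: "T \<in> PD n" and eq: "S * S = T * T"
  shows "S = T"
proof -
  obtain U s where U: "U \<in> carrier_mat n n" "U\<^sup>\<dagger> * U = 1\<^sub>m n" and s: "\<And>i. i < n \<Longrightarrow> 0 < s i"
    and Se: "S = U * rdiag n s * U\<^sup>\<dagger>" using PD_spectral[OF S] by blast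
  obtain V t where V: "V \<in> carrier_mat n n" "V\<^sup>\<dagger> * V = 1\<^sub>m n" and t: "\<And>i. i < n \<Longrightarrow> 0 < t i"
    and Te: "T = V * rdiag n t * V\<^sup>\<dagger>" using PD_spectral[OF T] by blast
  have UU: "U * U\<^sup>\<dagger> = 1\<^sub>m n" "V * V\<^sup>\<dagger> = 1\<^sub>m n"
    using mat_mult_left_right_inverse[OF _ U(1) U(2)] mat_mult_left_right_inverse[OF _ V(1) V(2)] U(1) V(1) by auto
  have dims: "dim_row U = n" "dim_col U = n" "dim_row V = n" "dim_col V = n" using U V by auto
  define W where "W = V\<^sup>\<dagger> * U"
  have Wd: "dim_row W = n" "dim_col W = n" using dims by (auto simp: W_def)
  have "rdiag n t * (rdiag n t * W) = V\<^sup>\<dagger> * (T * T) * U"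
    using dims V U by (simp add: Te W_def mult_assoc_dim mult_cancel_dim)
  also have "\<dots> = V\<^sup>\<dagger> * (S * S) * U" by (simp only: eq)
  also have "\<dots> = W * rdiag n s * rdiag n s"
    using dims V U by (simp add: Se W_def mult_assoc_dim mult_cancel_dim)
  finally have comm2: "rdiag n t * (rdiag n t * W) = W * rdiag n s * rdiag n s" .
  have "rdiag n t * W = W * rdiag n s"
  proof (rule eq_matI)
    fix i j assume "i < dim_row (W * rdiag n s)" "j < dim_col (W * rdiag n s)"
    then have ij: "i < n" "j < n" using Wd by auto
    have "complex_of_real (t i) * (complex_of_real (t i) * W $$ (i, j)) = (rdiag n t * (rdiag n t * W)) $$ (i, j)"
      using ij Wd by (simp del: index_mult_mat(1))
    also have "\<dots> = (W * rdiag n s * rdiag n s) $$ (i, j)" by (simp only: comm2)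
    also have "\<dots> = W $$ (i, j) * complex_of_real (s j) * complex_of_real (s j)"
      using ij Wd by (simp del: index_mult_mat(1))
    finally have "W $$ (i, j) = 0 \<or> complex_of_real (t i * t i) = complex_of_real (s j * s j)"
      by (simp add: algebra_simps)
    then have "W $$ (i, j) = 0 \<or> t i = s j"
      using s[OF ij(2)] t[OF ij(1)] by (metis abs_of_pos of_real_eq_iff real_sqrt_abs2)
    then show "(rdiag n t * W) $$ (i, j) = (W * rdiag n s) $$ (i, j)"
      using ij Wd by (auto simp del: index_mult_mat(1))
  qed (use Wd in auto)
  then have "V * (rdiag n t * W) * U\<^sup>\<dagger> = V * (W * rdiag n s) * U\<^sup>\<dagger>"
    by simp
  then show ?thesis
    using dims UU by (simp add: Se Te W_def mult_assoc_dim mult_cancel_dim)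
qed

lemma PD_sqrt:
  assumes Z: "Z \<in> PD n"
  shows "PD_sqrt Z \<in> PD n" "PD_sqrt Z * PD_sqrt Z = Z"
proof -
  have dZ: "dim_row Z = n" using Z by (auto simp: PD_def hermitian_mat_def)
  obtain U z where U: "U \<in> carrier_mat n n" "U\<^sup>\<dagger> * U = 1\<^sub>m n" and z: "\<And>i. i < n \<Longrightarrow> 0 < z i"
    and Ze: "Z = U * rdiag n z * U\<^sup>\<dagger>" using PD_spectral[OF Z] by blast
  have UU: "U * U\<^sup>\<dagger> = 1\<^sub>m n"
    using mat_mult_left_right_inverse[OF _ U(1) U(2)] U(1) by auto
  have dims: "dim_row U = n" "dim_col U = n" using U by auto
  \<comment> \<open>Fourth roots of the eigenvalues: the square root of \<open>Z\<close> is then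
    itself a Gram matrix, and \<open>PD_gram\<close> gives its positivity.\<close>
  define q where "q = (\<lambda>i. sqrt (sqrt (z i)))"
  define L where "L = U * rdiag n q"
  define K where "K = rdiag n (\<lambda>i. 1 / q i) * U\<^sup>\<dagger>"
  have "q i \<noteq> 0" if "i < n" for i using z[OF that] by (simp add: q_def)
  then have q: "rdiag n (\<lambda>i. q i * (1 / q i)) = 1\<^sub>m n"
    unfolding rdiag_one[symmetric] by (intro rdiag_cong) simp
  have "L * K = U * ((rdiag n q * rdiag n (\<lambda>i. 1 / q i)) * U\<^sup>\<dagger>)"
    using dims by (simp add: L_def K_def mult_assoc_dim)
  also have "\<dots> = 1\<^sub>m n" using dims UU by (simp only: rdiag_mult q) simp
  finally have LK: "L * K = 1\<^sub>m n" .
  have S: "L * L\<^sup>\<dagger> \<in> PD n"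
    by (rule PD_gram[OF _ _ LK]) (use U in \<open>auto simp: L_def K_def\<close>)
  have "L * L\<^sup>\<dagger> * (L * L\<^sup>\<dagger>) = U * (rdiag n q * rdiag n q * (rdiag n q * rdiag n q)) * U\<^sup>\<dagger>"
    using dims U by (simp add: L_def adjoint_mult mult_assoc_dim mult_cancel_dim)
  also have "rdiag n q * rdiag n q * (rdiag n q * rdiag n q) = rdiag n z"
    unfolding rdiag_mult by (rule rdiag_cong) (use z in \<open>auto simp: q_def less_imp_le\<close>)
  finally have SS: "L * L\<^sup>\<dagger> * (L * L\<^sup>\<dagger>) = Z" by (simp only: Ze)
  have "\<exists>!S. S \<in> PD (dim_row Z) \<and> S * S = Z"
    using S SS PD_sqrt_unique unfolding dZ by metis
  from theI'[OF this] show "PD_sqrt Z \<in> PD n" "PD_sqrt Z * PD_sqrt Z = Z"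
    unfolding PD_sqrt_def dZ by auto
qed

text \<open>By polar decomposition \<open>L\<close> is the positive square root of
  \<open>L * L\<^sup>\<dagger>\<close> times a unitary \<open>Q\<close>, and conjugation by
  \<open>Q\<close> preserves both the identity and the norm. Hence the gradient norm can be computed
  with any factor of \<open>Z\<close>, which is what leaves the basis free.\<close>

lemma frobenius_norm_gram_factor:
  assumes L: "L \<in> carrier_mat n n" and K: "K \<in> carrier_mat n n" and LK: "L * K = 1\<^sub>m n"
    and Y: "Y \<in> carrier_mat n n"
  shows "frobenius_norm (c \<cdot>\<^sub>m (PD_sqrt (L * L\<^sup>\<dagger>) * Y * PD_sqrt (L * L\<^sup>\<dagger>)) - 1\<^sub>m n)
    = frobenius_norm (c \<cdot>\<^sub>m (L\<^sup>\<dagger> * Y * L) - 1\<^sub>m n)"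
proof -
  define S where "S = PD_sqrt (L * L\<^sup>\<dagger>)"
  note PD = PD_gram[OF L K LK]
  have SPD: "S \<in> PD n" and SS: "S * S = L * L\<^sup>\<dagger>"
    using PD_sqrt[OF PD] by (auto simp: S_def)
  have Sc: "S \<in> carrier_mat n n" and Sadj: "S\<^sup>\<dagger> = S"
    using SPD by (auto simp: PD_def hermitian_mat_def)
  have dims: "dim_row S = n" "dim_col S = n" "dim_row L = n" "dim_col L = n" "dim_row K = n" "dim_col K = n"
    "dim_row Y = n" "dim_col Y = n"
    using Sc L K Y by auto
  \<comment> \<open>\<open>K\<^sup>\<dagger> * K\<close> is the inverse of \<open>S * S\<close>, so
    \<open>R\<close> is the inverse of \<open>S\<close>.\<close>
  define R where "R = S * K\<^sup>\<dagger> * K"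
  have Rc: "R \<in> carrier_mat n n" using Sc K by (auto simp: R_def)
  have LK': "L\<^sup>\<dagger> * K\<^sup>\<dagger> = 1\<^sub>m n"
    using mat_mult_left_right_inverse[OF L K LK] dims by (metis adjoint_mult adjoint_one)
  have "S * R = (S * S) * K\<^sup>\<dagger> * K" using dims by (simp add: R_def mult_assoc_dim)
  also have "\<dots> = 1\<^sub>m n"
    unfolding SS using dims LK LK' by (simp add: mult_assoc_dim mult_cancel_dim)
  finally have SR: "S * R = 1\<^sub>m n" .
  have RS: "R * S = 1\<^sub>m n" using mat_mult_left_right_inverse[OF Sc Rc SR] .
  have SR': "S * R\<^sup>\<dagger> = 1\<^sub>m n"
    using RS Sadj dims Rc by (metis adjoint_mult adjoint_one carrier_matD)
  define Q where "Q = R * L"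
  have Qc: "Q \<in> carrier_mat n n" using Rc L by (auto simp: Q_def)
  have SQ: "S * Q = L" using dims Rc SR by (simp add: Q_def mult_cancel_dim)
  have "Q * Q\<^sup>\<dagger> = R * (L * L\<^sup>\<dagger>) * R\<^sup>\<dagger>"
    using dims Rc by (simp add: Q_def adjoint_mult mult_assoc_dim)
  also have "\<dots> = 1\<^sub>m n"
    unfolding SS[symmetric] using dims Rc RS SR' by (simp add: mult_assoc_dim mult_cancel_dim)
  finally have QQ: "Q * Q\<^sup>\<dagger> = 1\<^sub>m n" .
  have QQ': "Q\<^sup>\<dagger> * Q = 1\<^sub>m n"
    using mat_mult_left_right_inverse[OF Qc _ QQ] Qc by simp
  define M where "M = S * Y * S"
  have Mc: "M \<in> carrier_mat n n" using Sc Y by (auto simp: M_def)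
  have "L\<^sup>\<dagger> * Y * L = Q\<^sup>\<dagger> * M * Q"
    using dims Qc Sadj unfolding SQ[symmetric] M_def by (simp add: adjoint_mult mult_assoc_dim)
  then have "c \<cdot>\<^sub>m (L\<^sup>\<dagger> * Y * L) - 1\<^sub>m n = Q\<^sup>\<dagger> * ((c \<cdot>\<^sub>m M - 1\<^sub>m n) * Q)"
    using Mc Qc QQ'
    by (simp add: minus_mult_distrib_mat[of _ n n] mult_minus_distrib_mat[of _ n n _ n]
        mult_smult_assoc_mat[of _ n n _ n] mult_smult_distrib[of _ n n _ n] assoc_mult_mat[of _ n n _ n _ n])
  also have "frobenius_norm \<dots> = frobenius_norm (c \<cdot>\<^sub>m M - 1\<^sub>m n)"
    using Qc Mc QQ QQ'
    by (subst frobenius_norm_isometry_left) (auto intro!: frobenius_norm_isometry_right)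
  finally show ?thesis by (simp add: M_def S_def)
qed

section \<open>Nearly balanced scalings of nonnegative matrices\<close>

lemma Cauchy_Schwarz_sum:
  fixes f g :: "'a \<Rightarrow> real"
  shows "(\<Sum>i\<in>S. f i * g i)\<^sup>2 \<le> (\<Sum>i\<in>S. (f i)\<^sup>2) * (\<Sum>i\<in>S. (g i)\<^sup>2)"
proof -
  have "\<bar>\<Sum>i\<in>S. f i * g i\<bar> \<le> (\<Sum>i\<in>S. \<bar>f i\<bar> * \<bar>g i\<bar>)"
    by (rule order_trans[OF sum_abs]) (simp add: abs_mult)
  also have "\<dots> \<le> L2_set f S * L2_set g S"
    by (rule L2_set_mult_ineq)
  finally have "\<bar>\<Sum>i\<in>S. f i * g i\<bar>\<^sup>2 \<le> (L2_set f S * L2_set g S)\<^sup>2"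
    by (intro power_mono) auto
  then show ?thesis
    by (simp add: L2_set_def power_mult_distrib sum_nonneg)
qed

text \<open>The Schur test: each weight is split into two square roots before Cauchy-Schwarz is
  applied to a row.\<close>

lemma weighted_Cauchy_Schwarz:
  fixes d :: "nat \<Rightarrow> nat \<Rightarrow> real"
  assumes d: "\<And>j i. j < n \<Longrightarrow> i < p \<Longrightarrow> 0 \<le> d j i"
    and row: "\<And>j. j < n \<Longrightarrow> (\<Sum>i<p. d j i) \<le> a"
    and col: "\<And>i. i < p \<Longrightarrow> (\<Sum>j<n. d j i) \<le> b"
    and "0 \<le> a"
  shows "(\<Sum>j<n. (\<Sum>i<p. d j i * x i)\<^sup>2) \<le> a * b * (\<Sum>i<p. (x i)\<^sup>2)"
proof -
  have "(\<Sum>i<p. d j i * x i)\<^sup>2 \<le> a * (\<Sum>i<p. d j i * (x i)\<^sup>2)"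
    if j: "j < n" for j
  proof -
    have "(\<Sum>i<p. d j i * x i) = (\<Sum>i<p. sqrt (d j i) * (sqrt (d j i) * x i))"
      using d[OF j] by (intro sum.cong) (auto simp flip: mult.assoc)
    also have "\<dots>\<^sup>2 \<le> (\<Sum>i<p. (sqrt (d j i))\<^sup>2) * (\<Sum>i<p. (sqrt (d j i) * x i)\<^sup>2)"
      by (rule Cauchy_Schwarz_sum)
    also have "\<dots> = (\<Sum>i<p. d j i) * (\<Sum>i<p. d j i * (x i)\<^sup>2)"
      using d[OF j] by (simp add: power_mult_distrib)
    also have "\<dots> \<le> a * (\<Sum>i<p. d j i * (x i)\<^sup>2)"
      using d[OF j] row[OF j] by (intro mult_right_mono sum_nonneg) auto
    finally show ?thesis .
  qed
  then have "(\<Sum>j<n. (\<Sum>i<p. d j i * x i)\<^sup>2) \<le> (\<Sum>j<n. a * (\<Sum>i<p. d j i * (x i)\<^sup>2))"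
    by (intro sum_mono) auto
  also have "\<dots> = a * (\<Sum>i<p. (\<Sum>j<n. d j i) * (x i)\<^sup>2)"
    unfolding sum_distrib_left[symmetric] by (subst sum.swap) (simp add: sum_distrib_right)
  also have "\<dots> \<le> a * (\<Sum>i<p. b * (x i)\<^sup>2)"
    using col \<open>0 \<le> a\<close> by (intro mult_left_mono sum_mono mult_right_mono) auto
  finally show ?thesis by (simp add: sum_distrib_left mult.assoc)
qed

text \<open>As \<open>x\<close> tends to minus infinity, \<open>x * (exp x - 1)\<close> grows only
  like \<open>- x\<close>, so a quadratic lower bound has to lose a factor proportional to the range
  of \<open>x\<close>.\<close>

lemma mult_exp_minus_one_ge:
  fixes x M :: real
  assumes "\<bar>x\<bar> \<le> M" "1 \<le> M"
  shows "x\<^sup>2 / (2 * M) \<le> x * (exp x - 1)"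
proof (cases "0 \<le> x")
  case True
  have "x\<^sup>2 / (2 * M) \<le> x\<^sup>2 / 1" using assms by (intro divide_left_mono) auto
  also have "\<dots> = x * x" by (simp add: power2_eq_square)
  also have "\<dots> \<le> x * (exp x - 1)"
    using True exp_ge_add_one_self[of x] by (intro mult_left_mono) linarith+
  finally show ?thesis .
next
  case False
  define y where "y = - x"
  have y: "0 < y" "1 + y \<le> 2 * M" using False assms by (auto simp: y_def)
  have "exp x = 1 / exp y" by (simp add: y_def exp_minus field_simps)
  also have "\<dots> \<le> 1 / (1 + y)"
    using y exp_ge_add_one_self[of y] by (intro divide_left_mono) auto
  finally have e: "y / (1 + y) \<le> 1 - exp x" using y by (simp add: field_simps)
  have "x\<^sup>2 / (2 * M) = y * (y / (2 * M))" by (simp add: y_def power2_eq_square)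
  also have "\<dots> \<le> y * (y / (1 + y))"
    using y by (intro mult_left_mono divide_left_mono) auto
  also have "\<dots> \<le> y * (1 - exp x)" using y e by (intro mult_left_mono) auto
  also have "\<dots> = x * (exp x - 1)" by (simp add: y_def algebra_simps)
  finally show ?thesis .
qed

text \<open>The sum of \<open>b j i * (z i / y j - 1) * ln (z i / y j)\<close> is the symmetrised relative entropy of
  the scaled and the unscaled weights. Since the row sums agree, it collapses to the pairing of
  \<open>g\<close> with \<open>ln z\<close>; from below it is controlled by a Dirichlet form with a spectral gap.\<close>

lemma expander_scaling_near_constant:
  fixes b :: "nat \<Rightarrow> nat \<Rightarrow> real" and z y g :: "nat \<Rightarrow> real"
  assumes p: "1 \<le> p" and l: "0 < l" "l \<le> 1" and \<kappa>: "0 < \<kappa>"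
    and b: "\<And>j i. j < n \<Longrightarrow> i < p \<Longrightarrow> 0 \<le> b j i"
    and row: "\<And>j. j < n \<Longrightarrow> (\<Sum>i<p. b j i) = 1"
    and col: "\<And>i. i < p \<Longrightarrow> (\<Sum>j<n. b j i) = \<kappa>"
    and gap: "\<And>x. (\<Sum>i<p. x i) = 0 \<Longrightarrow>
      (\<Sum>j<n. (\<Sum>i<p. b j i * x i)\<^sup>2) \<le> (1 - l)\<^sup>2 * \<kappa> * (\<Sum>i<p. (x i)\<^sup>2)"
    and z: "\<And>i. i < p \<Longrightarrow> 0 < z i"
    and y: "\<And>j. j < n \<Longrightarrow> y j = (\<Sum>i<p. b j i * z i)"
    and g: "\<And>i. i < p \<Longrightarrow> (\<Sum>j<n. b j i * (z i / y j)) = \<kappa> * (1 + g i)"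
    and \<gamma>: "sqrt (\<Sum>i<p. (g i)\<^sup>2) \<le> \<gamma>" "\<gamma> \<le> l / 8"
  obtains \<alpha> where "0 < \<alpha>" "\<And>i. i < p \<Longrightarrow> \<bar>ln (\<alpha> * z i)\<bar> \<le> 4 * \<gamma> / l"
    "\<And>j. j < n \<Longrightarrow> 0 < y j \<and> \<bar>ln (\<alpha> * y j)\<bar> \<le> 4 * \<gamma> / l"
proof -
  \<comment> \<open>The inverse of the geometric mean of the \<open>z i\<close>: it makes the
    \<open>h i\<close> sum to zero, so that \<open>gap\<close> applies to them.\<close>
  define \<alpha> where "\<alpha> = exp (- (\<Sum>i<p. ln (z i)) / real p)"
  have \<alpha>: "0 < \<alpha>" by (simp add: \<alpha>_def)
  define h where "h i = ln (\<alpha> * z i)" for i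
  define k where "k j = - ln (\<alpha> * y j)" for j
  define N where "N = sqrt (\<Sum>i<p. (h i)\<^sup>2)"
  have eh: "exp (h i) = \<alpha> * z i" if "i < p" for i
    using z[OF that] \<alpha> by (simp add: h_def)
  have "h i = ln \<alpha> + ln (z i)" if "i < p" for i
    using z[OF that] \<alpha> by (simp add: h_def ln_mult)
  then have "(\<Sum>i<p. h i) = (\<Sum>i<p. ln \<alpha> + ln (z i))"
    by simp
  also have "\<dots> = 0" using p by (simp add: sum.distrib) (simp add: \<alpha>_def)
  finally have h0: "(\<Sum>i<p. h i) = 0" .
  have N2: "N\<^sup>2 = (\<Sum>i<p. (h i)\<^sup>2)" and N: "0 \<le> N"
    by (auto simp: N_def sum_nonneg)
  have hN: "\<bar>h i\<bar> \<le> N" if "i < p" for i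
  proof -
    have "(h i)\<^sup>2 \<le> (\<Sum>i<p. (h i)\<^sup>2)" using that by (intro member_le_sum) auto
    then show ?thesis using N2 N by (metis abs_le_square_iff abs_of_nonneg)
  qed
  \<comment> \<open>\<open>\<alpha> * y j\<close> is a convex combination of the values
    \<open>exp (h i)\<close>, so it obeys the same bounds.\<close>
  have y_bounds: "exp (- N) \<le> \<alpha> * y j \<and> \<alpha> * y j \<le> exp N"
    if j: "j < n" for j
  proof -
    have e: "\<alpha> * y j = (\<Sum>i<p. b j i * exp (h i))"
      using y[OF j] eh by (simp add: sum_distrib_left algebra_simps)
    have "exp (- N) = (\<Sum>i<p. b j i * exp (- N))"
      using row[OF j] by (simp flip: sum_distrib_right)
    also have "\<dots> \<le> (\<Sum>i<p. b j i * exp (h i))"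
      using b[OF j] hN by (intro sum_mono mult_left_mono) (auto simp: abs_le_iff minus_le_iff)
    finally have 1: "exp (- N) \<le> \<alpha> * y j" using e by simp
    have "(\<Sum>i<p. b j i * exp (h i)) \<le> (\<Sum>i<p. b j i * exp N)"
      using b[OF j] hN by (intro sum_mono mult_left_mono) (auto simp: abs_le_iff)
    also have "\<dots> = exp N" using row[OF j] by (simp flip: sum_distrib_right)
    finally show ?thesis using e 1 by simp
  qed
  have ypos: "0 < y j" if "j < n" for j
    using y_bounds[OF that] \<alpha> by (metis exp_gt_zero less_le_trans zero_less_mult_pos)
  have kN: "\<bar>k j\<bar> \<le> N" if j: "j < n" for j
  proof -
    have pos: "0 < \<alpha> * y j" using ypos[OF j] \<alpha> by simp
    have "ln (exp (- N)) \<le> ln (\<alpha> * y j)" "ln (\<alpha> * y j) \<le> ln (exp N)"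
      using y_bounds[OF j] pos by (simp_all del: ln_exp)
    then show ?thesis by (simp add: k_def abs_le_iff)
  qed
  have ezy: "exp (h i + k j) = z i / y j" if "i < p" "j < n" for i j
    using eh[OF that(1)] ypos[OF that(2)] \<alpha> by (simp add: k_def exp_diff)
  have zy: "(\<Sum>i<p. b j i * (z i / y j)) = 1" if "j < n" for j
    using y[OF that] ypos[OF that] by (simp flip: sum_divide_distrib)
  have "(\<Sum>j<n. \<Sum>i<p. b j i * ((h i + k j) * (exp (h i + k j) - 1)))
      = (\<Sum>j<n. \<Sum>i<p. h i * (b j i * (z i / y j)) - h i * b j i + (k j * (b j i * (z i / y j)) - k j * b j i))"
    using ezy by (intro sum.cong) (auto simp: algebra_simps add_divide_distrib)
  also have "\<dots> = (\<Sum>j<n. \<Sum>i<p. h i * (b j i * (z i / y j))) - (\<Sum>j<n. \<Sum>i<p. h i * b j i)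
      + ((\<Sum>j<n. \<Sum>i<p. k j * (b j i * (z i / y j))) - (\<Sum>j<n. \<Sum>i<p. k j * b j i))"
    by (simp only: sum.distrib sum_subtractf)
  also have "(\<Sum>j<n. \<Sum>i<p. h i * (b j i * (z i / y j))) = (\<Sum>i<p. h i * (\<kappa> * (1 + g i)))"
    using g
    by (subst sum.swap) (auto simp only: sum_distrib_left[symmetric] lessThan_iff intro!: sum.cong)
  also have "(\<Sum>j<n. \<Sum>i<p. h i * b j i) = (\<Sum>i<p. h i * \<kappa>)"
    using col by (subst sum.swap) (simp flip: sum_distrib_left)
  also have "(\<Sum>j<n. \<Sum>i<p. k j * (b j i * (z i / y j))) = (\<Sum>j<n. k j)"
    using zy
    by (auto simp only: sum_distrib_left[symmetric] lessThan_iff mult_1_right intro!: sum.cong)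
  also have "(\<Sum>j<n. \<Sum>i<p. k j * b j i) = (\<Sum>j<n. k j)"
    using row by (simp flip: sum_distrib_left)
  also have "(\<Sum>i<p. h i * (\<kappa> * (1 + g i))) - (\<Sum>i<p. h i * \<kappa>) + ((\<Sum>j<n. k j) - (\<Sum>j<n. k j)) =
      \<kappa> * (\<Sum>i<p. g i * h i)"
    by (simp add: sum_distrib_left flip: sum_subtractf) (simp add: algebra_simps)
  finally have entropy: "(\<Sum>j<n. \<Sum>i<p. b j i * ((h i + k j) * (exp (h i + k j) - 1))) = \<kappa> * (\<Sum>i<p. g i * h i)" .
  \<comment> \<open>\<open>2 * N\<close> bounds all \<open>h i + k j\<close>; the added 1 secures
    \<open>1 \<le> M\<close> for \<open>mult_exp_minus_one_ge\<close>.\<close>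
  define M where "M = 1 + 2 * N"
  have M: "1 \<le> M" using N by (simp add: M_def)
  define R where "R j = (\<Sum>i<p. b j i * h i)" for j
  have "\<kappa> * l * N\<^sup>2 \<le> \<kappa> * N\<^sup>2 - (1 - l)\<^sup>2 * \<kappa> * N\<^sup>2"
  proof -
    have "l * l \<le> l * 1" using l by (intro mult_left_mono) auto
    then have "l \<le> 1 - (1 - l)\<^sup>2" by (simp add: power2_eq_square algebra_simps)
    then have "(\<kappa> * N\<^sup>2) * l \<le> (\<kappa> * N\<^sup>2) * (1 - (1 - l)\<^sup>2)"
      using \<kappa> by (intro mult_left_mono) auto
    then show ?thesis by (simp add: algebra_simps)
  qed
  also have "\<dots> \<le> \<kappa> * N\<^sup>2 - (\<Sum>j<n. (R j)\<^sup>2)"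
    using gap[OF h0] unfolding N2 R_def by simp
  also have "\<dots> \<le> (\<Sum>i<p. \<kappa> * (h i)\<^sup>2) + (\<Sum>j<n. 2 * k j * R j + (k j)\<^sup>2)"
  proof -
    \<comment> \<open>Completing the square in \<open>k j\<close>: the right-hand side is smallest
      at \<open>k j = - R j\<close>.\<close>
    have "- (R j)\<^sup>2 \<le> 2 * k j * R j + (k j)\<^sup>2" for j
      using zero_le_power2[of "k j + R j"] by (simp add: power2_eq_square algebra_simps)
    then have "(\<Sum>j<n. - (R j)\<^sup>2) \<le> (\<Sum>j<n. 2 * k j * R j + (k j)\<^sup>2)"
      by (intro sum_mono) auto
    then show ?thesis unfolding N2 sum_distrib_left by (simp add: sum_negf)
  qed
  also have "\<dots> = (\<Sum>j<n. \<Sum>i<p. b j i * (h i + k j)\<^sup>2)"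
  proof -
    have "(\<Sum>j<n. \<Sum>i<p. b j i * (h i + k j)\<^sup>2)
        = (\<Sum>j<n. \<Sum>i<p. b j i * (h i)\<^sup>2) + (\<Sum>j<n. \<Sum>i<p. 2 * k j * (b j i * h i) + b j i * (k j)\<^sup>2)"
      unfolding sum.distrib[symmetric]
      by (intro sum.cong) (auto simp: power2_eq_square algebra_simps)
    also have "(\<Sum>j<n. \<Sum>i<p. b j i * (h i)\<^sup>2) = (\<Sum>i<p. \<kappa> * (h i)\<^sup>2)"
      using col by (subst sum.swap) (simp flip: sum_distrib_right)
    also have "(\<Sum>j<n. \<Sum>i<p. 2 * k j * (b j i * h i) + b j i * (k j)\<^sup>2) = (\<Sum>j<n. 2 * k j * R j + (k j)\<^sup>2)"
      using row by (simp add: sum.distrib R_def flip: sum_distrib_left sum_distrib_right)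
    finally show ?thesis by simp
  qed
  also have "\<dots> \<le> (\<Sum>j<n. \<Sum>i<p. b j i * (2 * M * ((h i + k j) * (exp (h i + k j) - 1))))"
  proof (intro sum_mono mult_left_mono)
    fix j i assume ji: "j \<in> {..<n}" "i \<in> {..<p}"
    then have "\<bar>h i + k j\<bar> \<le> M" using hN[of i] kN[of j] by (auto simp: M_def)
    from mult_exp_minus_one_ge[OF this M] M
    show "(h i + k j)\<^sup>2 \<le> 2 * M * ((h i + k j) * (exp (h i + k j) - 1))"
      by (simp add: field_simps)
  qed (use b in auto)
  also have "\<dots> = 2 * M * (\<Sum>j<n. \<Sum>i<p. b j i * ((h i + k j) * (exp (h i + k j) - 1)))"
    by (simp add: sum_distrib_left mult_ac)
  also have "\<dots> = 2 * M * (\<kappa> * (\<Sum>i<p. g i * h i))"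
    by (simp only: entropy)
  also have "\<dots> \<le> 2 * M * (\<kappa> * (\<gamma> * N))"
  proof -
    have "(\<Sum>i<p. g i * h i) \<le> (\<Sum>i<p. \<bar>g i\<bar> * \<bar>h i\<bar>)"
      by (intro sum_mono) (simp flip: abs_mult)
    also have "\<dots> \<le> sqrt (\<Sum>i<p. (g i)\<^sup>2) * N"
      using L2_set_mult_ineq[of g h "{..<p}"] by (simp add: L2_set_def N_def)
    also have "\<dots> \<le> \<gamma> * N" using \<gamma> N by (intro mult_right_mono) auto
    finally show ?thesis using M \<kappa> by (intro mult_left_mono) auto
  qed
  finally have main: "\<kappa> * l * N\<^sup>2 \<le> 2 * M * (\<kappa> * (\<gamma> * N))" .
  \<comment> \<open>The factor \<open>M\<close> still contains \<open>N\<close>, so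
    \<open>main\<close> only yields \<open>l * N \<le> 2 * \<gamma> + 4 * \<gamma> * N\<close>. By
    \<open>\<gamma> \<le> l / 8\<close> the last term is at most half of the left-hand side and is
    absorbed; no bound on \<open>N\<close> has to be known beforehand.\<close>
  have "N \<le> 4 * \<gamma> / l"
  proof (cases "N = 0")
    case True
    have "0 \<le> \<gamma>" using \<gamma>(1) by (rule order_trans[rotated]) (simp add: sum_nonneg)
    then show ?thesis using True l by simp
  next
    case False
    then have "0 < \<kappa> * N" using N \<kappa> by simp
    moreover have "(\<kappa> * N) * (l * N) \<le> (\<kappa> * N) * (2 * M * \<gamma>)"
      using main by (simp add: power2_eq_square mult_ac)
    ultimately have "l * N \<le> 2 * M * \<gamma>" by (rule mult_le_cancel_left_pos[THEN iffD1])
    also have "\<dots> = 2 * \<gamma> + N * (4 * \<gamma>)" by (simp add: M_def algebra_simps)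
    also have "N * (4 * \<gamma>) \<le> N * (l / 2)" using N \<gamma> by (intro mult_left_mono) auto
    finally show ?thesis using l by (simp add: field_simps)
  qed
  then show ?thesis
    using that[OF \<alpha>] hN kN ypos by (force simp: h_def k_def)
qed

section \<open>Completely positive maps in eigenbases\<close>

lemma cp_map_Nil [simp]: "cp_map n [] Y = 0\<^sub>m n n"
  and cp_map_Cons [simp]: "cp_map n (A # As) Y = A * Y * A\<^sup>\<dagger> + cp_map n As Y"
  by (simp_all add: cp_map_def)

text \<open>Makes the dual a completely positive map in the opposite direction, so that facts on
  \<open>cp_map\<close> carry over to it.\<close>

lemma cp_dual_eq_cp_map: "cp_dual p As Y = cp_map p (map mat_adjoint As) Y"
  by (simp add: cp_dual_def cp_map_def comp_def)

lemma cp_map_dim [simp]: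
  assumes "set As \<subseteq> carrier_mat n p"
  shows "dim_row (cp_map n As Y) = n" "dim_col (cp_map n As Y) = n"
  using assms by (induction As) auto

lemma cp_map_carrier [simp]:
  "set As \<subseteq> carrier_mat n p \<Longrightarrow> cp_map n As Y \<in> carrier_mat n n"
  by (intro carrier_matI) auto

lemma adjoint_set_carrier [simp]:
  "set As \<subseteq> carrier_mat n p \<Longrightarrow> set (map mat_adjoint As) \<subseteq> carrier_mat p n"
  by auto

lemma cp_dual_carrier [simp]:
  "set As \<subseteq> carrier_mat n p \<Longrightarrow> cp_dual p As Y \<in> carrier_mat p p"
  unfolding cp_dual_eq_cp_map using adjoint_set_carrier cp_map_carrier by blast

lemma cp_map_index:
  assumes "set As \<subseteq> carrier_mat n p" "i < n" "j < n"
  shows "cp_map n As Y $$ (i, j) = (\<Sum>A\<leftarrow>As. (A * Y * A\<^sup>\<dagger>) $$ (i, j))"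
  using assms by (induction As) (auto simp del: index_mult_mat(1))

text \<open>Changes of basis and operator scalings are both performed on the Kraus operators; this
  translates them back to the map.\<close>

lemma cp_map_conjugate:
  assumes As: "set As \<subseteq> carrier_mat n p" and P: "P \<in> carrier_mat n n" and L: "L \<in> carrier_mat p p"
    and X: "X \<in> carrier_mat p p"
  shows "cp_map n (map (\<lambda>A. P * A * L) As) X = P * cp_map n As (L * X * L\<^sup>\<dagger>) * P\<^sup>\<dagger>"
  using As
proof (induction As)
  case Nil
  then show ?case using P by simp
next
  case (Cons A As)
  let ?C = "cp_map n As (L * X * L\<^sup>\<dagger>)" and ?D = "A * (L * X * L\<^sup>\<dagger>) * A\<^sup>\<dagger>"
  have A: "A \<in> carrier_mat n p" and As: "set As \<subseteq> carrier_mat n p"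
    using Cons.prems by auto
  have C: "?C \<in> carrier_mat n n" and D: "?D \<in> carrier_mat n n"
    using As A L X by (auto intro!: mult_carrier_mat[of _ n p] carrier_matI)
  have "P * A * L * X * (P * A * L)\<^sup>\<dagger> = P * ?D * P\<^sup>\<dagger>"
    using A P L X by (simp add: adjoint_mult mult_assoc_dim)
  moreover have "P * (?D + ?C) * P\<^sup>\<dagger> = P * ?D * P\<^sup>\<dagger> + P * ?C * P\<^sup>\<dagger>"
    using carrier_matD[OF C] carrier_matD[OF D] P by (simp add: mult_add_dim add_mult_dim)
  ultimately show ?case using Cons.IH[OF As] by simp
qed

lemma cp_dual_conjugate:
  assumes As: "set As \<subseteq> carrier_mat n p" and P: "P \<in> carrier_mat n n" and L: "L \<in> carrier_mat p p"
    and Y: "Y \<in> carrier_mat n n"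
  shows "cp_dual p (map (\<lambda>A. P * A * L) As) Y = L\<^sup>\<dagger> * cp_dual p As (P\<^sup>\<dagger> * Y * P) * L"
proof -
  have "map mat_adjoint (map (\<lambda>A. P * A * L) As) = map (\<lambda>B. L\<^sup>\<dagger> * B * P\<^sup>\<dagger>) (map mat_adjoint As)"
    using As P L by (auto simp: adjoint_mult mult_assoc_dim subset_iff)
  then show ?thesis
    unfolding cp_dual_eq_cp_map by (simp only:)
      (use cp_map_conjugate[of "map mat_adjoint As" p n "L\<^sup>\<dagger>" "P\<^sup>\<dagger>" Y] assms adjoint_set_carrier[OF As] in simp)
qed

lemma cp_map_add:
  assumes As: "set As \<subseteq> carrier_mat n p" and X: "X \<in> carrier_mat p p" and Y: "Y \<in> carrier_mat p p"
  shows "cp_map n As (X + Y) = cp_map n As X + cp_map n As Y"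
  using As
proof (induction As)
  case (Cons A As)
  let ?C = "cp_map n As X" and ?D = "cp_map n As Y"
  have A: "A \<in> carrier_mat n p" and As: "set As \<subseteq> carrier_mat n p"
    using Cons.prems by auto
  have e: "A * (X + Y) * A\<^sup>\<dagger> = A * X * A\<^sup>\<dagger> + A * Y * A\<^sup>\<dagger>"
    using A X Y by (simp add: mult_add_dim add_mult_dim)
  show ?case
    unfolding cp_map_Cons Cons.IH[OF As] e
    by (rule eq_matI) (use As A in \<open>auto simp del: index_mult_mat(1)\<close>)
qed simp

lemma cp_map_smult:
  assumes As: "set As \<subseteq> carrier_mat n p" and X: "X \<in> carrier_mat p p"
  shows "cp_map n As (c \<cdot>\<^sub>m X) = c \<cdot>\<^sub>m cp_map n As X"
  using As
proof (induction As)
  case (Cons A As)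
  have A: "A \<in> carrier_mat n p" and As: "set As \<subseteq> carrier_mat n p"
    using Cons.prems by auto
  have e: "A * (c \<cdot>\<^sub>m X) * A\<^sup>\<dagger> = c \<cdot>\<^sub>m (A * X * A\<^sup>\<dagger>)"
    using A X by (simp add: mult_smult_dim smult_mult_dim)
  show ?case
    unfolding cp_map_Cons Cons.IH[OF As] e
    by (rule eq_matI) (use As A in \<open>auto simp: algebra_simps simp del: index_mult_mat(1)\<close>)
qed (auto intro: eq_matI)

lemma cp_map_hermitian:
  assumes As: "set As \<subseteq> carrier_mat n p" and X: "hermitian_mat p X"
  shows "hermitian_mat n (cp_map n As X)"
proof -
  have "(cp_map n As X)\<^sup>\<dagger> = cp_map n As X"
    using As
  proof (induction As)
    case Nil
    show ?case by (rule eq_matI) auto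
  next
    case (Cons A As)
    have A: "A \<in> carrier_mat n p" and As: "set As \<subseteq> carrier_mat n p"
      using Cons.prems by auto
    have "(A * X * A\<^sup>\<dagger>)\<^sup>\<dagger> = A * X * A\<^sup>\<dagger>"
      using A X by (auto simp: hermitian_mat_def adjoint_mult mult_assoc_dim)
    moreover have "(B + C)\<^sup>\<dagger> = B\<^sup>\<dagger> + C\<^sup>\<dagger>"
      if "B \<in> carrier_mat n n" "C \<in> carrier_mat n n" for B C :: "complex mat"
      using that by (intro eq_matI) auto
    ultimately show ?case using Cons.IH[OF As] A As
      by (simp add: mult_carrier_mat[of _ n p])
        (metis A adjoint_carrier carrier_matI carrier_matD cp_map_carrier index_mult_mat(2,3))
  qed
  then show ?thesis using As by (simp add: hermitian_mat_def)
qed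

text \<open>The nonnegative matrix through which the map acts on diagonals. Its row and column sums
  are the diagonals of the images of the identity under the map and under its dual.\<close>

definition kraus_weight :: "complex mat list \<Rightarrow> nat \<Rightarrow> nat \<Rightarrow> real" where
  "kraus_weight As j i = (\<Sum>A\<leftarrow>As. (cmod (A $$ (j, i)))\<^sup>2)"

lemma kraus_weight_nonneg [simp]: "0 \<le> kraus_weight As j i"
  unfolding kraus_weight_def by (intro sum_list_nonneg) auto

lemma kraus_weight_adjoint:
  assumes "set As \<subseteq> carrier_mat n p" "j < n" "i < p"
  shows "kraus_weight (map mat_adjoint As) i j = kraus_weight As j i"
  using assms by (induction As) (auto simp: kraus_weight_def)

lemma cp_map_rdiag_index:
  assumes As: "set As \<subseteq> carrier_mat n p" and j: "j < n"
  shows "cp_map n As (rdiag p x) $$ (j, j) = complex_of_real (\<Sum>i<p. kraus_weight As j i * x i)"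
proof -
  have "(A * rdiag p x * A\<^sup>\<dagger>) $$ (j, j) = complex_of_real (\<Sum>i<p. (cmod (A $$ (j, i)))\<^sup>2 * x i)"
    if "A \<in> carrier_mat n p" for A
  proof -
    have "(A * rdiag p x * A\<^sup>\<dagger>) $$ (j, j) = (\<Sum>i<p. A $$ (j, i) * complex_of_real (x i) * cnj (A $$ (j, i)))"
      using that j by (subst mult_index_sum) (auto simp del: index_mult_mat(1))
    also have "\<dots> = complex_of_real (\<Sum>i<p. (cmod (A $$ (j, i)))\<^sup>2 * x i)"
      unfolding of_real_sum of_real_mult complex_norm_square by (simp add: mult_ac)
    finally show ?thesis .
  qed
  then have "cp_map n As (rdiag p x) $$ (j, j) = (\<Sum>A\<leftarrow>As. complex_of_real (\<Sum>i<p. (cmod (A $$ (j, i)))\<^sup>2 * x i))"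
    unfolding cp_map_index[OF As j j] using As by (intro arg_cong[of _ _ sum_list] map_cong) auto
  also have "\<dots> = complex_of_real (\<Sum>i<p. kraus_weight As j i * x i)"
    unfolding kraus_weight_def by (induction As) (simp_all add: sum.distrib algebra_simps)
  finally show ?thesis .
qed

lemma cp_dual_rdiag_index:
  assumes As: "set As \<subseteq> carrier_mat n p" and i: "i < p"
  shows "cp_dual p As (rdiag n y) $$ (i, i) = complex_of_real (\<Sum>j<n. kraus_weight As j i * y j)"
  unfolding cp_dual_eq_cp_map cp_map_rdiag_index[OF adjoint_set_carrier[OF As] i]
  using kraus_weight_adjoint[OF As _ i] by simp

text \<open>A diagonal entry of the conjugate is the average of the \<open>a k\<close> with weights
  \<open>(cmod (V $$ (k, j)))\<^sup>2\<close>, which sum to 1.\<close>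

lemma unitary_conjugate_rdiag_le:
  assumes V: "V \<in> carrier_mat n n" "V\<^sup>\<dagger> * V = 1\<^sub>m n" and j: "j < n"
    and le: "\<And>i. i < n \<Longrightarrow> a i \<le> c"
  shows "Re ((V\<^sup>\<dagger> * rdiag n a * V) $$ (j, j)) \<le> c"
proof -
  have one: "(\<Sum>k<n. (cmod (V $$ (k, j)))\<^sup>2) = 1"
  proof -
    have "complex_of_real (\<Sum>k<n. (cmod (V $$ (k, j)))\<^sup>2) = (V\<^sup>\<dagger> * V) $$ (j, j)"
      using V(1) j by (subst adjoint_mult_self_index) auto
    then show ?thesis using V(2) j by (metis index_one_mat(1) of_real_eq_1_iff)
  qed
  have "(V\<^sup>\<dagger> * rdiag n a * V) $$ (j, j) = (\<Sum>k<n. cnj (V $$ (k, j)) * complex_of_real (a k) * V $$ (k, j))"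
    using V(1) j by (subst mult_index_sum) (auto simp del: index_mult_mat(1))
  also have "\<dots> = complex_of_real (\<Sum>k<n. (cmod (V $$ (k, j)))\<^sup>2 * a k)"
    unfolding of_real_sum of_real_mult complex_norm_square by (simp add: mult_ac)
  finally have "Re ((V\<^sup>\<dagger> * rdiag n a * V) $$ (j, j)) = (\<Sum>k<n. (cmod (V $$ (k, j)))\<^sup>2 * a k)"
    by simp
  also have "\<dots> \<le> (\<Sum>k<n. (cmod (V $$ (k, j)))\<^sup>2 * c)"
    using le by (intro sum_mono mult_left_mono) auto
  also have "\<dots> = c" using one by (simp flip: sum_distrib_right)
  finally show ?thesis .
qed

text \<open>In eigenbases of the argument and of its image the map acts on eigenvalues through a
  nonnegative matrix, so that the Schur test applies.\<close>

lemma cp_map_frobenius_bound: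
  assumes Bs: "set Bs \<subseteq> carrier_mat n p"
    and a: "cp_map n Bs (1\<^sub>m p) = rdiag n a'" "\<And>j. j < n \<Longrightarrow> a' j \<le> a" "0 \<le> a"
    and b: "cp_dual p Bs (1\<^sub>m n) = rdiag p b'" "\<And>i. i < p \<Longrightarrow> b' i \<le> b"
    and X: "hermitian_mat p X"
  shows "(frobenius_norm (cp_map n Bs X))\<^sup>2 \<le> a * b * (frobenius_norm X)\<^sup>2"
proof -
  obtain U x where U: "U \<in> carrier_mat p p" "U\<^sup>\<dagger> * U = 1\<^sub>m p" "X = U * rdiag p x * U\<^sup>\<dagger>"
    using hermitian_spectral[OF X] by blast
  obtain V y where V: "V \<in> carrier_mat n n" "V\<^sup>\<dagger> * V = 1\<^sub>m n" "cp_map n Bs X = V * rdiag n y * V\<^sup>\<dagger>"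
    using hermitian_spectral[OF cp_map_hermitian[OF Bs X]] by blast
  have UU: "U * U\<^sup>\<dagger> = 1\<^sub>m p" and VV: "V * V\<^sup>\<dagger> = 1\<^sub>m n"
    using mat_mult_left_right_inverse[OF _ U(1) U(2)] mat_mult_left_right_inverse[OF _ V(1) V(2)] U(1) V(1) by auto
  define Es where "Es = map (\<lambda>A. V\<^sup>\<dagger> * A * U) Bs"
  have Es: "set Es \<subseteq> carrier_mat n p" using Bs U(1) V(1) by (auto simp: Es_def)
  have "cp_map n Es (rdiag p x) = V\<^sup>\<dagger> * cp_map n Bs X * V"
    unfolding Es_def U(3) using Bs U(1) V(1) by (subst cp_map_conjugate) auto
  also have "\<dots> = rdiag n y"
    unfolding V(3) using V(1,2) by (simp add: mult_assoc_dim mult_cancel_dim)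
  finally have Ey: "cp_map n Es (rdiag p x) = rdiag n y" .
  have y: "y j = (\<Sum>i<p. kraus_weight Es j i * x i)" if "j < n" for j
    using cp_map_rdiag_index[OF Es that, of x] that unfolding Ey
    by (simp only: rdiag_index refl if_True of_real_eq_iff)
  \<comment> \<open>The change of basis alters the row sums, but only to averages of the entries of
    \<open>a'\<close>.\<close>
  have "cp_map n Es (1\<^sub>m p) = V\<^sup>\<dagger> * rdiag n a' * V"
    unfolding Es_def using Bs U(1) V(1) UU a(1) by (subst cp_map_conjugate) auto
  then have row: "(\<Sum>i<p. kraus_weight Es j i) \<le> a" if "j < n" for j
    using cp_map_rdiag_index[OF Es that, of "\<lambda>_. 1"] unitary_conjugate_rdiag_le[OF V(1,2) that, of a' a] a(2)
    by (simp add: rdiag_one del: index_mult_mat(1))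
  have "cp_dual p Es (1\<^sub>m n) = U\<^sup>\<dagger> * rdiag p b' * U"
    unfolding Es_def using Bs U(1) V(1) VV b(1) by (subst cp_dual_conjugate) auto
  then have col: "(\<Sum>j<n. kraus_weight Es j i) \<le> b" if "i < p" for i
    using cp_dual_rdiag_index[OF Es that, of "\<lambda>_. 1"] unitary_conjugate_rdiag_le[OF U(1,2) that, of b' b] b(2)
    by (simp add: rdiag_one del: index_mult_mat(1))
  have "(frobenius_norm (cp_map n Bs X))\<^sup>2 = (\<Sum>j<n. (\<Sum>i<p. kraus_weight Es j i * x i)\<^sup>2)"
    unfolding V(3) frobenius_norm_unitary_conjugate[OF V(1,2) rdiag_carrier] frobenius_norm_rdiag
    by (intro sum.cong) (auto simp: y)
  also have "\<dots> \<le> a * b * (\<Sum>i<p. (x i)\<^sup>2)"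
    by (rule weighted_Cauchy_Schwarz) (use row col a(3) in auto)
  also have "(\<Sum>i<p. (x i)\<^sup>2) = (frobenius_norm X)\<^sup>2"
    unfolding U(3) frobenius_norm_unitary_conjugate[OF U(1,2) rdiag_carrier] frobenius_norm_rdiag ..
  finally show ?thesis .
qed

section \<open>Contraction of the Sinkhorn iteration\<close>

text \<open>The first factor collects the losses from normalisation, \<open>1 - l / 2\<close> is the
  rate of the scaled expander, and the last term is the second-order error. To first order the
  losses amount to \<open>6 * \<gamma>\<close>, at most \<open>6 * l / 64\<close>, which fits
  between \<open>1 - l / 2\<close> and \<open>1 - l / 4\<close>.\<close>

lemma contraction_rate_le:
  fixes l \<gamma> :: real
  assumes "0 < l" "l \<le> 1" "0 \<le> \<gamma>" "\<gamma> \<le> l\<^sup>2 / 64"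
  shows "(1 + \<gamma>)\<^sup>2 / (1 - \<gamma>) * ((1 - l / 2) + (1 + \<gamma>) * \<gamma> / (1 - \<gamma>)) \<le> 1 - l / 4"
proof -
  have "l\<^sup>2 \<le> l" using assms by (simp add: power2_eq_square mult_left_le)
  then have g: "\<gamma> \<le> l / 64" "\<gamma> \<le> 1 / 64" using assms by linarith+
  have g2: "\<gamma> * \<gamma> \<le> \<gamma> * (1 / 64)"
    using g assms by (intro mult_left_mono) auto
  have 1: "(1 + \<gamma>)\<^sup>2 / (1 - \<gamma>) \<le> 1 + 4 * \<gamma>"
    using g g2 assms by (simp add: pos_divide_le_eq power2_eq_square algebra_simps)
  have "(1 + \<gamma>) / (1 - \<gamma>) \<le> 2" using g by (simp add: pos_divide_le_eq)
  then have "\<gamma> * ((1 + \<gamma>) / (1 - \<gamma>)) \<le> \<gamma> * 2"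
    using assms by (intro mult_left_mono) auto
  then have 2: "(1 + \<gamma>) * \<gamma> / (1 - \<gamma>) \<le> 2 * \<gamma>"
    by (simp add: mult_ac)
  have "(1 + \<gamma>)\<^sup>2 / (1 - \<gamma>) * ((1 - l / 2) + (1 + \<gamma>) * \<gamma> / (1 - \<gamma>)) \<le> (1 + 4 * \<gamma>) * (1 - l / 2 + 2 * \<gamma>)"
    using 1 2 g assms by (intro mult_mono) auto
  also have "\<dots> \<le> 1 - l / 2 + 6 * \<gamma> + 8 * (\<gamma> * \<gamma>)"
    using assms by (simp add: algebra_simps)
  also have "\<dots> \<le> 1 - l / 4" using g g2 assms by linarith
  finally show ?thesis .
qed

text \<open>One step in coordinates where the map is unital and the gradient is
  \<open>rdiag p g\<close>. The new point is \<open>rdiag p (\<lambda>i. 1 / (1 + g i))\<close>. In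
  \<open>1 / m j = 1 + r j\<close> the summand 1 contributes exactly the identity to the new
  gradient, so what remains is a scaling of the dual image of \<open>r\<close>; and \<open>r\<close>
  is the diagonal of the image of \<open>g\<close> up to second order.\<close>

lemma balanced_contraction:
  fixes g q m :: "nat \<Rightarrow> real"
  assumes Ds: "set Ds \<subseteq> carrier_mat n p" and \<kappa>: "0 < \<kappa>" and l: "0 < l" "l \<le> 1"
    and unital: "cp_map n Ds (1\<^sub>m p) = 1\<^sub>m n"
    and dual: "cp_dual p Ds (1\<^sub>m n) = rdiag p (\<lambda>i. \<kappa> * (1 + g i))"
    and m: "cp_map n Ds (rdiag p (\<lambda>i. 1 / (1 + g i))) = rdiag n m"
    and gap: "frobenius_norm (cp_map n Ds (rdiag p g)) \<le> (1 - l / 2) * sqrt \<kappa> * \<gamma>"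
    and \<gamma>: "frobenius_norm (rdiag p g) = \<gamma>" "\<gamma> \<le> l\<^sup>2 / 64"
  shows "\<And>i. i < p \<Longrightarrow> 0 < 1 + g i" "\<And>j. j < n \<Longrightarrow> 0 < m j"
    and "frobenius_norm (complex_of_real (1 / \<kappa>) \<cdot>\<^sub>m (rdiag p (\<lambda>i. sqrt (1 / (1 + g i)))
        * cp_dual p Ds (rdiag n (\<lambda>j. 1 / m j)) * rdiag p (\<lambda>i. sqrt (1 / (1 + g i)))) - 1\<^sub>m p)
      \<le> (1 - l / 4) * \<gamma>"
proof -
  define q where "q = (\<lambda>i. 1 / (1 + g i))"
  define d where "d = kraus_weight Ds"
  have \<gamma>0: "0 \<le> \<gamma>" using \<gamma>(1) frobenius_norm_nonneg by metis
  have "l\<^sup>2 \<le> 1" using l by (simp add: power_le_one)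
  then have \<gamma>1: "\<gamma> \<le> 1 / 64" using \<gamma>(2) by linarith
  have g2: "(\<Sum>i<p. (g i)\<^sup>2) = \<gamma>\<^sup>2"
    using frobenius_norm_rdiag[of p g] \<gamma>(1) by simp
  have g: "\<bar>g i\<bar> \<le> \<gamma>" if "i < p" for i
  proof -
    have "(g i)\<^sup>2 \<le> (\<Sum>i<p. (g i)\<^sup>2)" using that by (intro member_le_sum) auto
    then show ?thesis using g2 \<gamma>0 by (metis abs_le_square_iff abs_of_nonneg)
  qed
  then have gpos: "1 - \<gamma> \<le> 1 + g i" "1 + g i \<le> 1 + \<gamma>"
    if "i < p" for i using that by (force simp: abs_le_iff)+
  show "0 < 1 + g i" if "i < p" for i using gpos[OF that] \<gamma>1 by linarith
  have q: "0 < q i" "1 / (1 + \<gamma>) \<le> q i" "q i \<le> 1 / (1 - \<gamma>)" if "i < p" for i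
    using gpos[OF that] \<gamma>0 \<gamma>1 by (auto simp: q_def intro!: divide_left_mono)
  have d: "0 \<le> d j i" for j i by (simp add: d_def)
  have row: "(\<Sum>i<p. d j i) = 1" if "j < n" for j
    using cp_map_rdiag_index[OF Ds that, of "\<lambda>_. 1"] that unital
    by (simp add: rdiag_one d_def flip: of_real_sum)
  have col: "(\<Sum>j<n. d j i) = \<kappa> * (1 + g i)" if "i < p" for i
  proof -
    have "complex_of_real (\<Sum>j<n. d j i) = complex_of_real (\<kappa> * (1 + g i))"
      using cp_dual_rdiag_index[OF Ds that, of "\<lambda>_. 1"] that dual
      by (simp add: rdiag_one d_def)
    then show ?thesis by (simp only: of_real_eq_iff)
  qed
  have mj: "m j = (\<Sum>i<p. d j i * q i)" if "j < n" for j
  proof -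
    have "complex_of_real (m j) = complex_of_real (\<Sum>i<p. d j i * q i)"
      using cp_map_rdiag_index[OF Ds that, of q] that m by (simp add: d_def q_def)
    then show ?thesis by (simp only: of_real_eq_iff)
  qed
  have mlow: "1 / (1 + \<gamma>) \<le> m j" if "j < n" for j
  proof -
    have "1 / (1 + \<gamma>) = (\<Sum>i<p. d j i * (1 / (1 + \<gamma>)))"
      unfolding sum_distrib_right[symmetric] row[OF that] by simp
    also have "\<dots> \<le> m j"
      unfolding mj[OF that] using q d by (intro sum_mono mult_left_mono) auto
    finally show ?thesis .
  qed
  show mpos: "0 < m j" if "j < n" for j
    using mlow[OF that] \<gamma>0 by (smt (verit) zero_less_divide_1_iff)
  define r where "r = (\<lambda>j. 1 / m j - 1)"
  \<comment> \<open>From the exact identity \<open>1 - q i = g i - (g i)\<^sup>2 * q i\<close>: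
    \<open>u\<close> is the linear part, to which \<open>gap\<close> applies, and \<open>t\<close>
    the quadratic remainder.\<close>
  define u where "u = (\<lambda>j. \<Sum>i<p. d j i * g i)"
  define t where "t = (\<lambda>j. \<Sum>i<p. d j i * ((g i)\<^sup>2 * q i))"
  have ut: "1 - m j = u j - t j" if "j < n" for j
  proof -
    have "1 - m j = (\<Sum>i<p. d j i * (1 - q i))"
      by (simp add: row[OF that] mj[OF that] algebra_simps sum_subtractf)
    also have "\<dots> = (\<Sum>i<p. d j i * (g i - (g i)\<^sup>2 * q i))"
    proof (intro sum.cong refl arg_cong2[of _ _ _ _ "(*)"])
      fix i assume "i \<in> {..<p}"
      then have "1 + g i \<noteq> 0" using gpos[of i] \<gamma>1 by auto
      then show "1 - q i = g i - (g i)\<^sup>2 * q i"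
        by (simp add: q_def field_simps power2_eq_square)
    qed
    finally show ?thesis by (simp add: u_def t_def algebra_simps sum_subtractf)
  qed
  have rle: "\<bar>r j\<bar> \<le> (1 + \<gamma>) * (\<bar>u j\<bar> + \<bar>t j\<bar>)"
    if "j < n" for j
  proof -
    have "r j = (1 / m j) * (u j - t j)"
      using mpos[OF that] ut[OF that] by (simp add: r_def field_simps)
    then have "\<bar>r j\<bar> = (1 / m j) * \<bar>u j - t j\<bar>"
      using mpos[OF that] by (simp add: abs_mult)
    also have "\<dots> \<le> (1 + \<gamma>) * (\<bar>u j\<bar> + \<bar>t j\<bar>)"
    proof (rule mult_mono)
      show "1 / m j \<le> 1 + \<gamma>"
        using mlow[OF that] mpos[OF that] \<gamma>0 by (simp add: field_simps)
    qed (use \<gamma>0 in auto)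
    finally show ?thesis .
  qed
  have Lu: "L2_set u {..<n} \<le> (1 - l / 2) * sqrt \<kappa> * \<gamma>"
  proof -
    have "(\<Sum>j<n. (u j)\<^sup>2) = (\<Sum>j<n. (cmod (cp_map n Ds (rdiag p g) $$ (j, j)))\<^sup>2)"
      using cp_map_rdiag_index[OF Ds, of _ g]
      by (auto simp: u_def d_def norm_of_real simp del: of_real_sum of_real_mult intro!: sum.cong)
    also have "\<dots> \<le> (frobenius_norm (cp_map n Ds (rdiag p g)))\<^sup>2"
      using Ds by (intro frobenius_norm_diag_le) simp
    finally have "L2_set u {..<n} \<le> frobenius_norm (cp_map n Ds (rdiag p g))"
      unfolding L2_set_def by (rule real_le_lsqrt[rotated 1]) simp
    then show ?thesis using gap by linarith
  qed
  \<comment> \<open>The Schur test with row sums 1 and column sums at most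
    \<open>\<kappa> * (1 + \<gamma>)\<close>. One of the two factors \<open>g i\<close> is bounded
    by \<open>\<gamma>\<close>, which makes the term second order.\<close>
  have Lt: "L2_set t {..<n} \<le> sqrt \<kappa> * ((1 + \<gamma>) * \<gamma> / (1 - \<gamma>)) * \<gamma>"
  proof -
    have "(\<Sum>j<n. (t j)\<^sup>2) \<le> 1 * (\<kappa> * (1 + \<gamma>)) * (\<Sum>i<p. ((g i)\<^sup>2 * q i)\<^sup>2)"
      unfolding t_def
      by (rule weighted_Cauchy_Schwarz) (use d row col gpos \<kappa> in auto)
    also have "\<dots> \<le> 1 * (\<kappa> * (1 + \<gamma>)) * (\<Sum>i<p. (\<gamma> / (1 - \<gamma>))\<^sup>2 * (g i)\<^sup>2)"
    proof (intro mult_left_mono sum_mono)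
      fix i assume "i \<in> {..<p}"
      then have i: "i < p" by simp
      have "\<bar>g i * q i\<bar> \<le> \<gamma> * (1 / (1 - \<gamma>))"
        unfolding abs_mult using g[OF i] q[OF i] \<gamma>0 by (intro mult_mono) auto
      then have "(g i * q i)\<^sup>2 \<le> (\<gamma> / (1 - \<gamma>))\<^sup>2"
        by (metis abs_ge_zero mult.right_neutral power2_abs power_mono times_divide_eq_right)
      then have "(g i * q i)\<^sup>2 * (g i)\<^sup>2 \<le> (\<gamma> / (1 - \<gamma>))\<^sup>2 * (g i)\<^sup>2"
        by (intro mult_right_mono) auto
      then show "((g i)\<^sup>2 * q i)\<^sup>2 \<le> (\<gamma> / (1 - \<gamma>))\<^sup>2 * (g i)\<^sup>2"
        by (simp add: power2_eq_square mult_ac)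
    qed (use \<kappa> \<gamma>0 in auto)
    also have "\<dots> = \<kappa> * (1 + \<gamma>) * ((\<gamma> / (1 - \<gamma>)) * \<gamma>)\<^sup>2"
      unfolding sum_distrib_left[symmetric] g2 by (simp add: power_mult_distrib power_divide)
    \<comment> \<open>\<open>1 + \<gamma>\<close> is enlarged to its square so that no root of it is
      left when the square is undone.\<close>
    also have "\<dots> \<le> \<kappa> * (1 + \<gamma>)\<^sup>2 * ((\<gamma> / (1 - \<gamma>)) * \<gamma>)\<^sup>2"
      using \<kappa> \<gamma>0
      by (intro mult_right_mono mult_left_mono) (auto simp: power2_eq_square)
    also have "\<dots> = (sqrt \<kappa> * ((1 + \<gamma>) * \<gamma> / (1 - \<gamma>)) * \<gamma>)\<^sup>2"
      using \<kappa> by (simp add: power_mult_distrib power_divide)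
    finally show ?thesis
      unfolding L2_set_def using \<kappa> \<gamma>0 \<gamma>1
      by (intro real_le_lsqrt) (auto intro!: mult_nonneg_nonneg divide_nonneg_nonneg sum_nonneg)
  qed
  define E where "E = (1 - l / 2) + (1 + \<gamma>) * \<gamma> / (1 - \<gamma>)"
  have "L2_set r {..<n} \<le> L2_set (\<lambda>j. (1 + \<gamma>) * (\<bar>u j\<bar> + \<bar>t j\<bar>)) {..<n}"
  proof -
    have "L2_set r {..<n} = L2_set (\<lambda>j. \<bar>r j\<bar>) {..<n}" by (simp add: L2_set_def)
    also have "\<dots> \<le> L2_set (\<lambda>j. (1 + \<gamma>) * (\<bar>u j\<bar> + \<bar>t j\<bar>)) {..<n}"
      using rle by (intro L2_set_mono) auto
    finally show ?thesis .
  qed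
  also have "\<dots> = (1 + \<gamma>) * L2_set (\<lambda>j. \<bar>u j\<bar> + \<bar>t j\<bar>) {..<n}"
    using \<gamma>0 by (simp add: L2_set_right_distrib)
  also have "\<dots> \<le> (1 + \<gamma>) * (L2_set u {..<n} + L2_set t {..<n})"
    using L2_set_triangle_ineq[of "\<lambda>j. \<bar>u j\<bar>" "\<lambda>j. \<bar>t j\<bar>" "{..<n}"] \<gamma>0
    by (intro mult_left_mono) (auto simp: L2_set_def)
  also have "\<dots> \<le> (1 + \<gamma>) * ((1 - l / 2) * sqrt \<kappa> * \<gamma> + sqrt \<kappa> * ((1 + \<gamma>) * \<gamma> / (1 - \<gamma>)) * \<gamma>)"
    using Lu Lt \<gamma>0 by (intro mult_left_mono add_mono) auto
  also have "\<dots> = (1 + \<gamma>) * sqrt \<kappa> * E * \<gamma>"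
    unfolding E_def by (simp only: algebra_simps)
  finally have Lr: "L2_set r {..<n} \<le> (1 + \<gamma>) * sqrt \<kappa> * E * \<gamma>" .
  define R where "R = cp_dual p Ds (rdiag n r)"
  have Rc: "R \<in> carrier_mat p p" using Ds by (simp add: R_def)
  \<comment> \<open>The Schur test for the dual, with row and column sums exchanged. This
    \<open>sqrt \<kappa>\<close> and the one in \<open>Lr\<close> cancel the factor
    \<open>1 / \<kappa>\<close> of the gradient.\<close>
  have FR: "frobenius_norm R \<le> sqrt \<kappa> * (1 + \<gamma>) * L2_set r {..<n}"
  proof -
    have "(frobenius_norm R)\<^sup>2 \<le> (\<kappa> * (1 + \<gamma>)) * 1 * (frobenius_norm (rdiag n r))\<^sup>2"
      unfolding R_def cp_dual_eq_cp_map
    proof (rule cp_map_frobenius_bound[of _ p n "\<lambda>i. \<kappa> * (1 + g i)" _ "\<lambda>_. 1"])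
      show "cp_map p (map mat_adjoint Ds) (1\<^sub>m n) = rdiag p (\<lambda>i. \<kappa> * (1 + g i))"
        using dual by (simp add: cp_dual_eq_cp_map)
      have "map (\<lambda>A. (A\<^sup>\<dagger>)\<^sup>\<dagger>) Ds = Ds" by simp
      then show "cp_dual n (map mat_adjoint Ds) (1\<^sub>m p) = rdiag n (\<lambda>_. 1)"
        using unital by (simp add: cp_dual_eq_cp_map rdiag_one comp_def)
    qed (use Ds \<kappa> \<gamma>0 gpos in auto)
    also have "\<dots> \<le> \<kappa> * (1 + \<gamma>)\<^sup>2 * (frobenius_norm (rdiag n r))\<^sup>2"
      using \<kappa> \<gamma>0 by (intro mult_right_mono) (auto simp: power2_eq_square)
    also have "\<dots> = (sqrt \<kappa> * (1 + \<gamma>) * L2_set r {..<n})\<^sup>2"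
      using \<kappa> by (simp add: frobenius_norm_rdiag L2_set_def power_mult_distrib sum_nonneg)
    finally show ?thesis
      by (rule power2_le_imp_le) (use \<kappa> \<gamma>0 in auto)
  qed
  let ?M = "complex_of_real (1 / \<kappa>) \<cdot>\<^sub>m (rdiag p (\<lambda>i. sqrt (q i))
        * cp_dual p Ds (rdiag n (\<lambda>j. 1 / m j)) * rdiag p (\<lambda>i. sqrt (q i))) - 1\<^sub>m p"
  have Cc: "cp_dual p Ds (rdiag n (\<lambda>j. 1 / m j)) \<in> carrier_mat p p" using Ds by simp
  have split: "cp_dual p Ds (rdiag n (\<lambda>j. 1 / m j)) = rdiag p (\<lambda>i. \<kappa> * (1 + g i)) + R"
  proof -
    have "rdiag n (\<lambda>j. 1 / m j) = 1\<^sub>m n + rdiag n r"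
      by (rule eq_matI) (auto simp: r_def)
    then show ?thesis
      unfolding R_def dual[symmetric] cp_dual_eq_cp_map
      using cp_map_add[OF adjoint_set_carrier[OF Ds], of "1\<^sub>m n" "rdiag n r"] by simp
  qed
  \<comment> \<open>The factors \<open>1 / \<kappa>\<close> and \<open>q i\<close> turn the diagonal
    part \<open>\<kappa> * (1 + g i)\<close> into exactly 1, which the subtracted identity
    removes.\<close>
  have entry: "?M $$ (i, j) = complex_of_real (1 / \<kappa> * (sqrt (q i) * sqrt (q j))) * R $$ (i, j)"
    if ij: "i < p" "j < p" for i j
  proof -
    have "?M $$ (i, j) = complex_of_real (1 / \<kappa>) * (complex_of_real (sqrt (q i)) *
        (cp_dual p Ds (rdiag n (\<lambda>j. 1 / m j)) $$ (i, j)) * complex_of_real (sqrt (q j))) - (if i = j then 1 else 0)"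
      using ij carrier_matD[OF Cc] by (simp del: index_mult_mat(1))
    also have "cp_dual p Ds (rdiag n (\<lambda>j. 1 / m j)) $$ (i, j) = (if i = j then complex_of_real (\<kappa> * (1 + g i)) else 0) + R $$ (i, j)"
      unfolding split using ij Rc by simp
    also have "complex_of_real (1 / \<kappa>) * (complex_of_real (sqrt (q i)) *
        ((if i = j then complex_of_real (\<kappa> * (1 + g i)) else 0) + R $$ (i, j)) * complex_of_real (sqrt (q j))) - (if i = j then 1 else 0)
      = complex_of_real (1 / \<kappa> * (sqrt (q i) * sqrt (q j))) * R $$ (i, j)"
    proof (cases "i = j")
      case True
      have "1 / \<kappa> * (sqrt (q i) * (\<kappa> * (1 + g i)) * sqrt (q i)) = (sqrt (q i) * sqrt (q i)) * (1 + g i)"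
        using \<kappa> by simp
      also have "\<dots> = 1" using q[OF ij(1)] gpos[OF ij(1)] \<gamma>1 by (simp add: q_def)
      finally have "complex_of_real (1 / \<kappa> * (sqrt (q i) * (\<kappa> * (1 + g i)) * sqrt (q i))) = 1"
        by (simp only: of_real_1)
      then show ?thesis unfolding of_real_mult using True by (simp add: algebra_simps)
    next
      case False
      then show ?thesis by (simp add: mult_ac)
    qed
    finally show ?thesis .
  qed
  have "frobenius_norm ?M \<le> (1 / (\<kappa> * (1 - \<gamma>))) * frobenius_norm R"
  proof (rule frobenius_norm_le_scale)
    fix i j assume "i < dim_row R" "j < dim_col R"
    then have ij: "i < p" "j < p" using Rc by auto
    have "sqrt (q i) * sqrt (q j) \<le> sqrt (1 / (1 - \<gamma>)) * sqrt (1 / (1 - \<gamma>))"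
      using q[OF ij(1)] q[OF ij(2)] \<gamma>1 by (intro mult_mono) (auto intro!: real_sqrt_le_mono)
    also have "\<dots> = 1 / (1 - \<gamma>)" using \<gamma>1 by simp
    finally have "1 / \<kappa> * (sqrt (q i) * sqrt (q j)) \<le> 1 / \<kappa> * (1 / (1 - \<gamma>))"
      using \<kappa> by (intro mult_left_mono) auto
    moreover have "0 \<le> 1 / \<kappa> * (sqrt (q i) * sqrt (q j))"
      using \<kappa> q[OF ij(1)] q[OF ij(2)] by simp
    ultimately show "cmod (?M $$ (i, j)) \<le> 1 / (\<kappa> * (1 - \<gamma>)) * cmod (R $$ (i, j))"
      unfolding entry[OF ij] norm_mult norm_of_real by (intro mult_right_mono) auto
  qed (use Rc \<kappa> \<gamma>1 in auto)
  also have "\<dots> \<le> (1 / (\<kappa> * (1 - \<gamma>))) * (sqrt \<kappa> * (1 + \<gamma>) * ((1 + \<gamma>) * sqrt \<kappa> * E * \<gamma>))"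
  proof -
    have "sqrt \<kappa> * (1 + \<gamma>) * L2_set r {..<n} \<le> sqrt \<kappa> * (1 + \<gamma>) * ((1 + \<gamma>) * sqrt \<kappa> * E * \<gamma>)"
      using Lr \<kappa> \<gamma>0 by (intro mult_left_mono) auto
    from order_trans[OF FR this] show ?thesis using \<kappa> \<gamma>1
    by (intro mult_left_mono) auto
  qed
  also have "\<dots> = (sqrt \<kappa> * sqrt \<kappa> / \<kappa>) * ((1 + \<gamma>)\<^sup>2 / (1 - \<gamma>) * E) * \<gamma>"
    by (simp add: power2_eq_square)
  also have "\<dots> = ((1 + \<gamma>)\<^sup>2 / (1 - \<gamma>) * E) * \<gamma>"
    using \<kappa> by simp
  also have "\<dots> \<le> (1 - l / 4) * \<gamma>"
    unfolding E_def using contraction_rate_le[OF l \<gamma>0 \<gamma>(2)] \<gamma>0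
    by (intro mult_right_mono) auto
  finally show "frobenius_norm (complex_of_real (1 / \<kappa>) \<cdot>\<^sub>m (rdiag p (\<lambda>i. sqrt (1 / (1 + g i)))
        * cp_dual p Ds (rdiag n (\<lambda>j. 1 / m j)) * rdiag p (\<lambda>i. sqrt (1 / (1 + g i)))) - 1\<^sub>m p)
      \<le> (1 - l / 4) * \<gamma>" by (simp only: q_def)
qed

text \<open>Scaling the input can destroy \<open>mat_trace X = 0\<close>, so \<open>gap\<close> is
  applied to \<open>X\<close> itself and the difference \<open>D\<close> is estimated by the
  operator norm \<open>sqrt \<kappa>\<close>. In all this gives the factor
  \<open>exp \<epsilon> * (exp \<epsilon> - l)\<close>, roughly
  \<open>1 - l + 2 * \<epsilon>\<close>; hence the requirement that \<open>\<epsilon>\<close> be a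
  small multiple of \<open>l\<close>.\<close>

lemma scaled_expander:
  assumes Cs: "set Cs \<subseteq> carrier_mat n p" and \<kappa>: "0 < \<kappa>" and l: "0 < l" "l \<le> 1"
    and unital: "cp_map n Cs (1\<^sub>m p) = 1\<^sub>m n"
    and dual: "cp_dual p Cs (1\<^sub>m n) = rdiag p (\<lambda>_. \<kappa>)"
    and gap: "\<And>X. hermitian_mat p X \<Longrightarrow> mat_trace X = 0 \<Longrightarrow>
      frobenius_norm (cp_map n Cs X) \<le> (1 - l) * sqrt \<kappa> * frobenius_norm X"
    and u: "\<And>i. i < p \<Longrightarrow> exp (- \<epsilon> / 2) \<le> u i \<and> u i \<le> exp (\<epsilon> / 2)"
    and v: "\<And>j. j < n \<Longrightarrow> 0 \<le> v j \<and> v j \<le> exp (\<epsilon> / 2)"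
    and \<epsilon>: "0 \<le> \<epsilon>" "\<epsilon> \<le> l / 16"
    and X: "hermitian_mat p X" "mat_trace X = 0"
  shows "frobenius_norm (cp_map n (map (\<lambda>C. rdiag n v * C * rdiag p u) Cs) X)
    \<le> (1 - l / 2) * sqrt \<kappa> * frobenius_norm X"
proof -
  have Xc: "X \<in> carrier_mat p p" using X by (simp add: hermitian_mat_def)
  define X1 where "X1 = rdiag p u * X * rdiag p u"
  define D where "D = X1 - X"
  have X1c: "X1 \<in> carrier_mat p p" using Xc by (intro carrier_matI) (auto simp: X1_def)
  have Dc: "D \<in> carrier_mat p p" using Xc by (simp add: D_def minus_carrier_mat)
  have X1h: "hermitian_mat p X1"
    using hermitian_conjugate[OF X(1), of "rdiag p u"] by (simp add: X1_def)
  have Dh: "hermitian_mat p D"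
  proof -
    have "D\<^sup>\<dagger> = X1\<^sup>\<dagger> - X\<^sup>\<dagger>"
      unfolding D_def using X1c Xc by (intro eq_matI) auto
    then show ?thesis using X1h X(1) Dc by (simp add: hermitian_mat_def D_def)
  qed
  have X1D: "X1 = X + D" unfolding D_def using X1c Xc by (intro eq_matI) auto
  have e1: "1 \<le> exp \<epsilon>" using \<epsilon> by simp
  have ee: "exp \<epsilon> = exp (\<epsilon> / 2) * exp (\<epsilon> / 2)" "exp (- \<epsilon>) = exp (- \<epsilon> / 2) * exp (- \<epsilon> / 2)"
    by (simp_all flip: exp_add)
  have "frobenius_norm D \<le> (exp \<epsilon> - 1) * frobenius_norm X"
  proof (rule frobenius_norm_le_scale)
    fix i j assume "i < dim_row X" "j < dim_col X"
    then have ij: "i < p" "j < p" using Xc by auto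
    have "D $$ (i, j) = complex_of_real (u i * u j - 1) * X $$ (i, j)"
      using ij Xc by (simp add: D_def X1_def algebra_simps del: index_mult_mat(1))
    moreover have "\<bar>u i * u j - 1\<bar> \<le> exp \<epsilon> - 1"
    proof -
      have u0: "0 \<le> u i" "0 \<le> u j"
        using u[OF ij(1)] u[OF ij(2)] by (meson exp_ge_zero order_trans)+
      have "u i * u j \<le> exp \<epsilon>"
        unfolding ee(1) using u[OF ij(1)] u[OF ij(2)] u0 by (intro mult_mono) auto
      moreover have "exp (- \<epsilon>) \<le> u i * u j"
        unfolding ee(2) using u[OF ij(1)] u[OF ij(2)] u0 by (intro mult_mono) auto
      \<comment> \<open>Makes the downward deviation \<open>1 - exp (- \<epsilon>)\<close> no larger
        than the upward one.\<close>
      moreover have "2 \<le> exp \<epsilon> + exp (- \<epsilon>)"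
        using exp_ge_add_one_self[of \<epsilon>] exp_ge_add_one_self[of "- \<epsilon>"] by linarith
      ultimately show ?thesis by linarith
    qed
    ultimately show "cmod (D $$ (i, j)) \<le> (exp \<epsilon> - 1) * cmod (X $$ (i, j))"
      by (simp add: norm_mult norm_of_real mult_right_mono del: of_real_diff of_real_mult)
  qed (use Xc Dc e1 in auto)
  moreover have "frobenius_norm (cp_map n Cs D) \<le> sqrt \<kappa> * frobenius_norm D"
  proof -
    have "(frobenius_norm (cp_map n Cs D))\<^sup>2 \<le> 1 * \<kappa> * (frobenius_norm D)\<^sup>2"
      by (rule cp_map_frobenius_bound[of _ n p "\<lambda>_. 1" _ "\<lambda>_. \<kappa>"])
        (use Cs unital dual Dh in \<open>auto simp: rdiag_one\<close>)
    also have "\<dots> = (sqrt \<kappa> * frobenius_norm D)\<^sup>2"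
      using \<kappa> by (simp add: power_mult_distrib)
    finally show ?thesis by (rule power2_le_imp_le) (use \<kappa> in auto)
  qed
  ultimately have D2: "frobenius_norm (cp_map n Cs D) \<le> sqrt \<kappa> * ((exp \<epsilon> - 1) * frobenius_norm X)"
    using \<kappa> by (meson mult_left_mono order_trans real_sqrt_ge_zero less_imp_le)
  have "cp_map n Cs X1 = cp_map n Cs X + cp_map n Cs D"
    unfolding X1D by (rule cp_map_add[OF Cs Xc Dc])
  then have "frobenius_norm (cp_map n Cs X1) \<le> frobenius_norm (cp_map n Cs X) + frobenius_norm (cp_map n Cs D)"
    using frobenius_norm_triangle[of "cp_map n Cs X" n n] Cs by simp
  also have "\<dots> \<le> (1 - l) * sqrt \<kappa> * frobenius_norm X + sqrt \<kappa> * ((exp \<epsilon> - 1) * frobenius_norm X)"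
    using gap[OF X] D2 by simp
  also have "\<dots> = (exp \<epsilon> - l) * (sqrt \<kappa> * frobenius_norm X)"
    by (simp add: algebra_simps)
  finally have X1b: "frobenius_norm (cp_map n Cs X1) \<le> (exp \<epsilon> - l) * (sqrt \<kappa> * frobenius_norm X)" .
  have "cp_map n (map (\<lambda>C. rdiag n v * C * rdiag p u) Cs) X = rdiag n v * cp_map n Cs X1 * rdiag n v"
    unfolding X1_def using Cs Xc by (subst cp_map_conjugate) auto
  also have "frobenius_norm \<dots> \<le> exp \<epsilon> * frobenius_norm (cp_map n Cs X1)"
  proof (rule frobenius_norm_le_scale)
    fix i j assume "i < dim_row (cp_map n Cs X1)" "j < dim_col (cp_map n Cs X1)"
    then have ij: "i < n" "j < n" using Cs by auto
    have "(rdiag n v * cp_map n Cs X1 * rdiag n v) $$ (i, j) = complex_of_real (v i * v j) * cp_map n Cs X1 $$ (i, j)"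
      using ij Cs by (simp add: mult_ac del: index_mult_mat(1))
    moreover have "\<bar>v i * v j\<bar> \<le> exp \<epsilon>"
      unfolding ee(1) abs_mult using v[OF ij(1)] v[OF ij(2)] by (intro mult_mono) auto
    ultimately show "cmod ((rdiag n v * cp_map n Cs X1 * rdiag n v) $$ (i, j)) \<le> exp \<epsilon> * cmod (cp_map n Cs X1 $$ (i, j))"
      by (simp add: norm_mult norm_of_real mult_right_mono del: of_real_mult index_mult_mat(1))
  qed (use Cs in auto)
  also have "\<dots> \<le> exp \<epsilon> * ((exp \<epsilon> - l) * (sqrt \<kappa> * frobenius_norm X))"
    using X1b by (intro mult_left_mono) auto
  also have "\<dots> = (exp \<epsilon> * (exp \<epsilon> - l)) * (sqrt \<kappa> * frobenius_norm X)"
    by simp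
  also have "\<dots> \<le> (1 - l / 2) * (sqrt \<kappa> * frobenius_norm X)"
  proof (rule mult_right_mono)
    have \<epsilon>1: "\<epsilon> \<le> 1" using \<epsilon> l by linarith
    have sq: "\<epsilon> * \<epsilon> \<le> \<epsilon> * 1"
      using \<epsilon> \<epsilon>1 by (intro mult_left_mono) auto
    have "exp \<epsilon> \<le> 1 + \<epsilon> + \<epsilon>\<^sup>2"
      using exp_bound[OF \<epsilon>(1) \<epsilon>1] .
    then have e2: "exp \<epsilon> \<le> 1 + 2 * \<epsilon>" using sq by (simp add: power2_eq_square)
    have "l \<le> exp \<epsilon>" using e1 l by linarith
    then have "exp \<epsilon> * (exp \<epsilon> - l) \<le> (1 + 2 * \<epsilon>) * (1 + 2 * \<epsilon> - l)"
      using e2 \<epsilon> by (intro mult_mono) linarith+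
    also have "\<dots> = 1 + 4 * \<epsilon> + 4 * (\<epsilon> * \<epsilon>) - l - 2 * (\<epsilon> * l)"
      by (simp add: algebra_simps)
    also have "\<dots> \<le> 1 - l / 2"
    proof -
      have "\<epsilon> * \<epsilon> \<le> \<epsilon> * (1 / 16)"
        using \<epsilon> l by (intro mult_left_mono) auto
      moreover have "0 \<le> \<epsilon> * l" using \<epsilon> l by simp
      ultimately show ?thesis using \<epsilon> l by linarith
    qed
    finally show "exp \<epsilon> * (exp \<epsilon> - l) \<le> 1 - l / 2" .
  qed (use \<kappa> in auto)
  finally show ?thesis by (simp add: mult.assoc)
qed

section \<open>A single Sinkhorn step: coordinates, normalisation and contraction\<close>

definition sinkhorn_step :: "nat \<Rightarrow> nat \<Rightarrow> complex mat list \<Rightarrow> complex mat \<Rightarrow> complex mat" where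
  "sinkhorn_step n p As Z = mat_inv (complex_of_real (real p / real n) \<cdot>\<^sub>m
       cp_dual p As (mat_inv (cp_map n As Z)))"

text \<open>Connects the iteration with the normal form of \<open>balanced_contraction\<close>. By
  \<open>dual\<close> the matrix to be inverted becomes diagonal after conjugation with
  \<open>L\<close>, so a step leads to \<open>L * rdiag p q * L\<^sup>\<dagger>\<close>; by
  \<open>Dq\<close> the image of that point becomes \<open>rdiag n m\<close> after conjugation with
  \<open>P\<close> and is inverted there.\<close>

lemma sinkhorn_step_coordinates:
  assumes As: "set As \<subseteq> carrier_mat n p" and np: "1 \<le> n" "1 \<le> p"
    and L: "L \<in> carrier_mat p p" "K \<in> carrier_mat p p" "L * K = 1\<^sub>m p"
    and P: "P \<in> carrier_mat n n" "J \<in> carrier_mat n n" "P * J = 1\<^sub>m n"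
    and W: "P\<^sup>\<dagger> * P = mat_inv (cp_map n As Z)"
    and Ds: "Ds = map (\<lambda>A. P * A * L) As"
    and \<kappa>: "\<kappa> = real n / real p"
    and q: "\<And>i. i < p \<Longrightarrow> 0 < q i" and m: "\<And>j. j < n \<Longrightarrow> 0 < m j"
    and dual: "cp_dual p Ds (1\<^sub>m n) = rdiag p (\<lambda>i. \<kappa> * (1 / q i))"
    and Dq: "cp_map n Ds (rdiag p q) = rdiag n m"
  shows "sinkhorn_step n p As Z \<in> PD p"
    and "frobenius_norm (geodesic_grad n p As (sinkhorn_step n p As Z)) =
      frobenius_norm (complex_of_real (1 / \<kappa>) \<cdot>\<^sub>m (rdiag p (\<lambda>i. sqrt (q i))
        * cp_dual p Ds (rdiag n (\<lambda>j. 1 / m j)) * rdiag p (\<lambda>i. sqrt (q i))) - 1\<^sub>m p)"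
proof -
  have \<kappa>0: "0 < \<kappa>" and \<kappa>i: "real p / real n = 1 / \<kappa>"
    using np by (auto simp: \<kappa>)
  have dims: "dim_row L = p" "dim_col L = p" "dim_row K = p" "dim_col K = p"
    "dim_row P = n" "dim_col P = n" "dim_row J = n" "dim_col J = n" using L P by auto
  have KL: "K * L = 1\<^sub>m p" and JP: "J * P = 1\<^sub>m n"
    using mat_mult_left_right_inverse[OF L] mat_mult_left_right_inverse[OF P] by auto
  have adjinv: "L\<^sup>\<dagger> * K\<^sup>\<dagger> = 1\<^sub>m p" "K\<^sup>\<dagger> * L\<^sup>\<dagger> = 1\<^sub>m p" "J\<^sup>\<dagger> * P\<^sup>\<dagger> = 1\<^sub>m n" "P\<^sup>\<dagger> * J\<^sup>\<dagger> = 1\<^sub>m n"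
    using KL JP L(3) P(3) dims by (metis adjoint_mult adjoint_one)+
  \<comment> \<open>A Gram factor of the new point, to which both \<open>PD_gram\<close> and
    \<open>frobenius_norm_gram_factor\<close> apply.\<close>
  define L1 where "L1 = L * rdiag p (\<lambda>i. sqrt (q i))"
  define K1 where "K1 = rdiag p (\<lambda>i. 1 / sqrt (q i)) * K"
  define Z1 where "Z1 = L1 * L1\<^sup>\<dagger>"
  have L1c: "L1 \<in> carrier_mat p p" and K1c: "K1 \<in> carrier_mat p p"
    using L by (auto simp: L1_def K1_def)
  have sq: "rdiag p (\<lambda>i. sqrt (q i)) * rdiag p (\<lambda>i. 1 / sqrt (q i)) = 1\<^sub>m p"
  proof (rule rdiag_inverse)
    fix i assume "i < p" then show "sqrt (q i) * (1 / sqrt (q i)) = 1" using q[of i] by simp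
  qed
  have LK1: "L1 * K1 = 1\<^sub>m p"
    using dims sq L(3) by (simp add: L1_def K1_def mult_assoc_dim mult_cancel_dim)
  have sqq: "rdiag p (\<lambda>i. sqrt (q i)) * rdiag p (\<lambda>i. sqrt (q i)) = rdiag p q"
    unfolding rdiag_mult by (rule rdiag_cong) (use q in \<open>auto simp: less_imp_le\<close>)
  have "Z1 = L * (rdiag p (\<lambda>i. sqrt (q i)) * rdiag p (\<lambda>i. sqrt (q i))) * L\<^sup>\<dagger>"
    using dims by (simp add: Z1_def L1_def adjoint_mult mult_assoc_dim)
  then have Z1: "Z1 = L * rdiag p q * L\<^sup>\<dagger>" by (simp only: sqq)
  have Z1c: "Z1 \<in> carrier_mat p p" using L1c by (simp add: Z1_def)
  define F where "F = cp_dual p As (mat_inv (cp_map n As Z))"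
  have Fc: "F \<in> carrier_mat p p" using As by (simp add: F_def)
  have "L\<^sup>\<dagger> * F * L = rdiag p (\<lambda>i. \<kappa> * (1 / q i))"
    using cp_dual_conjugate[OF As P(1) L(1), of "1\<^sub>m n"] dual dims unfolding Ds F_def W[symmetric] by simp
  then have "K\<^sup>\<dagger> * rdiag p (\<lambda>i. \<kappa> * (1 / q i)) * K = K\<^sup>\<dagger> * (L\<^sup>\<dagger> * F * L) * K"
    by simp
  also have "\<dots> = F" using dims Fc adjinv L(3) by (simp add: mult_assoc_dim mult_cancel_dim)
  finally have F: "F = K\<^sup>\<dagger> * rdiag p (\<lambda>i. \<kappa> * (1 / q i)) * K" by simp
  have dd: "complex_of_real (1 / \<kappa>) \<cdot>\<^sub>m (rdiag p (\<lambda>i. \<kappa> * (1 / q i)) * rdiag p q) = 1\<^sub>m p"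
  proof (rule eq_matI)
    fix i j assume "i < dim_row (1\<^sub>m p :: complex mat)" "j < dim_col (1\<^sub>m p :: complex mat)"
    then show "(complex_of_real (1 / \<kappa>) \<cdot>\<^sub>m (rdiag p (\<lambda>i. \<kappa> * (1 / q i)) * rdiag p q)) $$ (i, j) = 1\<^sub>m p $$ (i, j)"
      using q[of i] \<kappa>0 by (auto simp: rdiag_mult)
  qed auto
  have "(complex_of_real (1 / \<kappa>) \<cdot>\<^sub>m F) * Z1
      = K\<^sup>\<dagger> * (complex_of_real (1 / \<kappa>) \<cdot>\<^sub>m (rdiag p (\<lambda>i. \<kappa> * (1 / q i)) * rdiag p q)) * L\<^sup>\<dagger>"
    using dims KL unfolding F Z1
    by (simp add: mult_assoc_dim mult_cancel_dim smult_mult_dim mult_smult_dim)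
  also have "\<dots> = 1\<^sub>m p" unfolding dd using adjinv dims by simp
  finally have step: "sinkhorn_step n p As Z = Z1"
    unfolding sinkhorn_step_def \<kappa>i F_def[symmetric]
    by (intro mat_inv_eqI[of _ p]) (use Fc Z1c in auto)
  show "sinkhorn_step n p As Z \<in> PD p" unfolding step Z1_def by (rule PD_gram[OF L1c K1c LK1])
  have "P * cp_map n As Z1 * P\<^sup>\<dagger> = rdiag n m"
    using cp_map_conjugate[OF As P(1) L(1), of "rdiag p q"] Dq unfolding Ds Z1 by simp
  then have "J * rdiag n m * J\<^sup>\<dagger> = J * (P * cp_map n As Z1 * P\<^sup>\<dagger>) * J\<^sup>\<dagger>"
    by simp
  also have "\<dots> = cp_map n As Z1"
    using dims JP adjinv As by (simp add: mult_assoc_dim mult_cancel_dim)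
  finally have PhiZ1: "cp_map n As Z1 = J * rdiag n m * J\<^sup>\<dagger>" by simp
  have mm: "rdiag n m * rdiag n (\<lambda>j. 1 / m j) = 1\<^sub>m n"
  proof (rule rdiag_inverse)
    fix j assume "j < n" then show "m j * (1 / m j) = 1" using m[of j] by simp
  qed
  have inv1: "mat_inv (cp_map n As Z1) = P\<^sup>\<dagger> * rdiag n (\<lambda>j. 1 / m j) * P"
  proof (rule mat_inv_eqI[of _ n])
    show "cp_map n As Z1 * (P\<^sup>\<dagger> * rdiag n (\<lambda>j. 1 / m j) * P) = 1\<^sub>m n"
      unfolding PhiZ1 using dims adjinv mm JP by (simp add: mult_assoc_dim mult_cancel_dim)
  qed (use As P in \<open>auto intro!: carrier_matI\<close>)
  let ?Y = "cp_dual p As (P\<^sup>\<dagger> * rdiag n (\<lambda>j. 1 / m j) * P)"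
  have Yc: "?Y \<in> carrier_mat p p" using As by simp
  have "L1\<^sup>\<dagger> * ?Y * L1 = rdiag p (\<lambda>i. sqrt (q i)) * (L\<^sup>\<dagger> * ?Y * L) * rdiag p (\<lambda>i. sqrt (q i))"
    using dims carrier_matD[OF Yc] by (simp add: L1_def adjoint_mult mult_assoc_dim)
  also have "L\<^sup>\<dagger> * ?Y * L = cp_dual p Ds (rdiag n (\<lambda>j. 1 / m j))"
    unfolding Ds using cp_dual_conjugate[OF As P(1) L(1), of "rdiag n (\<lambda>j. 1 / m j)"] by simp
  finally have LYL: "L1\<^sup>\<dagger> * ?Y * L1 = rdiag p (\<lambda>i. sqrt (q i)) * cp_dual p Ds (rdiag n (\<lambda>j. 1 / m j)) * rdiag p (\<lambda>i. sqrt (q i))" .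
  show "frobenius_norm (geodesic_grad n p As (sinkhorn_step n p As Z)) =
      frobenius_norm (complex_of_real (1 / \<kappa>) \<cdot>\<^sub>m (rdiag p (\<lambda>i. sqrt (q i))
        * cp_dual p Ds (rdiag n (\<lambda>j. 1 / m j)) * rdiag p (\<lambda>i. sqrt (q i))) - 1\<^sub>m p)"
    unfolding step geodesic_grad_def inv1 \<kappa>i LYL[symmetric] unfolding Z1_def
    by (rule frobenius_norm_gram_factor[OF L1c K1c LK1 Yc])
qed

text \<open>\<open>quantum_expander\<close> admits the zero map, which cannot be normalised. Its
  gradient is minus the identity, whose norm is the square root of \<open>p\<close> and thus at
  least 1, so a small gradient excludes it.\<close>

lemma quantum_expander_size_pos:
  assumes np: "1 \<le> n" "1 \<le> p" and exp: "quantum_expander n p \<epsilon> As" and Z: "Z \<in> PD p"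
    and small: "frobenius_norm (geodesic_grad n p As Z) < 1"
  shows "0 < cp_size n p As"
proof (rule ccontr)
  assume neg: "\<not> 0 < cp_size n p As"
  have As: "set As \<subseteq> carrier_mat n p" using exp by (simp add: quantum_expander_def)
  have one: "cp_map n As (1\<^sub>m p) = complex_of_real (cp_size n p As / real n) \<cdot>\<^sub>m 1\<^sub>m n"
    using exp by (simp add: quantum_expander_def)
  \<comment> \<open>The weights are nonnegative with row sums
    \<open>cp_size n p As / real n\<close>, so a nonpositive size forces all of them to
    vanish.\<close>
  have w0: "kraus_weight As j i = 0" if ji: "j < n" "i < p" for j i
  proof -
    have "complex_of_real (\<Sum>i<p. kraus_weight As j i) = complex_of_real (cp_size n p As / real n)"
      using cp_map_rdiag_index[OF As ji(1), of "\<lambda>_. 1"] ji one by (simp add: rdiag_one)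
    then have "(\<Sum>i<p. kraus_weight As j i) = cp_size n p As / real n"
      by (simp only: of_real_eq_iff)
    also have "\<dots> \<le> 0" using neg np by (simp add: field_simps)
    finally have "(\<Sum>i<p. kraus_weight As j i) = 0" by (intro antisym sum_nonneg) auto
    then show ?thesis using ji by (simp add: sum_nonneg_eq_0_iff)
  qed
  have A0: "A = 0\<^sub>m n p" if "A \<in> set As" for A
  proof (rule eq_matI)
    fix j i assume "j < dim_row (0\<^sub>m n p :: complex mat)" "i < dim_col (0\<^sub>m n p :: complex mat)"
    then have ji: "j < n" "i < p" by auto
    have "(cmod (A $$ (j, i)))\<^sup>2 \<le> kraus_weight As j i"
      unfolding kraus_weight_def using that by (intro member_le_sum_list) auto
    then show "A $$ (j, i) = 0\<^sub>m n p $$ (j, i)" using w0[OF ji] ji by simp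
  qed (use As that in auto)
  define W where "W = mat_inv (cp_map n As Z)"
  have Wc: "W \<in> carrier_mat n n" using As by (simp add: W_def)
  have "foldr (+) (map (\<lambda>A. A\<^sup>\<dagger> * W * A) Bs) (0\<^sub>m p p) = 0\<^sub>m p p"
    if "set Bs \<subseteq> set As" for Bs
    using that
  proof (induction Bs)
    case (Cons B Bs)
    have "B = 0\<^sub>m n p" using A0 Cons.prems by auto
    then have "B\<^sup>\<dagger> * W * B = 0\<^sub>m p p" using Wc by (intro eq_matI) auto
    then show ?case using Cons by simp
  qed simp
  then have d0: "cp_dual p As W = 0\<^sub>m p p" by (simp add: cp_dual_def)
  define S where "S = PD_sqrt Z"
  have Sc: "S \<in> carrier_mat p p"
    using PD_sqrt(1)[OF Z] by (simp add: S_def PD_def hermitian_mat_def)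
  have "geodesic_grad n p As Z = rdiag p (\<lambda>_. - 1)"
    unfolding geodesic_grad_def W_def[symmetric] d0 S_def[symmetric] using Sc
    by (intro eq_matI) auto
  then have "(frobenius_norm (geodesic_grad n p As Z))\<^sup>2 = real p"
    by (simp add: frobenius_norm_rdiag)
  moreover have "(frobenius_norm (geodesic_grad n p As Z))\<^sup>2 < 1"
    using power_strict_mono[OF small, of 2] by simp
  ultimately show False using np by simp
qed

text \<open>Three lists of Kraus operators are derived from \<open>As\<close>. \<open>Cs\<close> is
  unital, in eigenbases of \<open>Z\<close> and of its image, and keeps the original gap; its
  weights enter the entropy estimate. \<open>Bs\<close> is normalised by \<open>Z\<close> and its
  image, and that estimate shows it to be a scaling of \<open>Cs\<close> close to the identity, so
  it inherits half of the gap. \<open>Ds\<close> is \<open>Bs\<close> in the bases that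
  \<open>balanced_contraction\<close> asks for.\<close>

lemma sinkhorn_step_contraction:
  assumes np: "1 \<le> n" "1 \<le> p" and l: "0 < l" "l \<le> 1" and exp: "quantum_expander n p (1 - l) As"
    and Z: "Z \<in> PD p" and small: "frobenius_norm (geodesic_grad n p As Z) \<le> l\<^sup>2 / 64"
  shows "sinkhorn_step n p As Z \<in> PD p"
    and "frobenius_norm (geodesic_grad n p As (sinkhorn_step n p As Z))
      \<le> (1 - l / 4) * frobenius_norm (geodesic_grad n p As Z)"
proof -
  define \<kappa> where "\<kappa> = real n / real p"
  define s where "s = cp_size n p As"
  \<comment> \<open>The factor that makes the map unital; the dual then sends the identity to
    \<open>\<kappa>\<close> times the identity.\<close>
  define \<beta> where "\<beta> = real n / s"
  define \<gamma> where "\<gamma> = frobenius_norm (geodesic_grad n p As Z)"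
  have \<kappa>: "0 < \<kappa>" and \<kappa>i: "real p / real n = 1 / \<kappa>"
    using np by (auto simp: \<kappa>_def)
  have \<gamma>: "0 \<le> \<gamma>" "\<gamma> \<le> l\<^sup>2 / 64"
    using small by (auto simp: \<gamma>_def)
  have l2: "l\<^sup>2 \<le> l" "l\<^sup>2 \<le> 1"
    using l by (simp_all add: power2_eq_square mult_left_le mult_le_one)
  have s: "0 < s" unfolding s_def
    by (rule quantum_expander_size_pos[OF np exp Z]) (use \<gamma> l2 in \<open>simp add: \<gamma>_def\<close>)
  have \<beta>: "0 < \<beta>" using s np by (simp add: \<beta>_def)
  have As: "set As \<subseteq> carrier_mat n p"
    and one: "cp_map n As (1\<^sub>m p) = complex_of_real (s / real n) \<cdot>\<^sub>m 1\<^sub>m n"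
    and dual_one: "cp_dual p As (1\<^sub>m n) = complex_of_real (s / real p) \<cdot>\<^sub>m 1\<^sub>m p"
    and expand: "\<And>X. hermitian_mat p X \<Longrightarrow> mat_trace X = 0 \<Longrightarrow>
        frobenius_norm (cp_map n As X) \<le> (1 - l) * (s / sqrt (real n * real p)) * frobenius_norm X"
    using exp by (auto simp: quantum_expander_def s_def)

  \<comment> \<open>The unital operators \<open>Cs\<close> in eigenbases of \<open>Z\<close> and of
    its image\<close>
  obtain U z where U: "U \<in> carrier_mat p p" "U\<^sup>\<dagger> * U = 1\<^sub>m p" and z: "\<And>i. i < p \<Longrightarrow> 0 < z i"
    and Ze: "Z = U * rdiag p z * U\<^sup>\<dagger>" using PD_spectral[OF Z] by blast
  have Zh: "hermitian_mat p Z" using Z by (simp add: PD_def)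
  obtain V y where V: "V \<in> carrier_mat n n" "V\<^sup>\<dagger> * V = 1\<^sub>m n" and PhiZ: "cp_map n As Z = V * rdiag n y * V\<^sup>\<dagger>"
    using hermitian_spectral[OF cp_map_hermitian[OF As Zh]] by blast
  have UU: "U * U\<^sup>\<dagger> = 1\<^sub>m p" and VV: "V * V\<^sup>\<dagger> = 1\<^sub>m n"
    using mat_mult_left_right_inverse[OF _ U] mat_mult_left_right_inverse[OF _ V] U(1) V(1) by auto
  have dims: "dim_row U = p" "dim_col U = p" "dim_row V = n" "dim_col V = n" using U V by auto

  define T where "T = complex_of_real (sqrt \<beta>) \<cdot>\<^sub>m U"
  have Tc: "T \<in> carrier_mat p p" using U by (simp add: T_def)
  have Tadj: "T\<^sup>\<dagger> = complex_of_real (sqrt \<beta>) \<cdot>\<^sub>m U\<^sup>\<dagger>"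
    unfolding T_def by (rule eq_matI) auto
  have \<beta>\<beta>: "complex_of_real (sqrt \<beta>) * complex_of_real (sqrt \<beta>) = complex_of_real \<beta>"
    using \<beta> by (simp flip: of_real_mult)
  have TX: "T * X * T\<^sup>\<dagger> = complex_of_real \<beta> \<cdot>\<^sub>m (U * X * U\<^sup>\<dagger>)"
    if "X \<in> carrier_mat p p" for X
    unfolding Tadj using that dims
    by (simp add: T_def smult_mult_dim mult_smult_dim \<beta>\<beta> smult_smult_mat)
  have TT: "T\<^sup>\<dagger> * X * T = complex_of_real \<beta> \<cdot>\<^sub>m (U\<^sup>\<dagger> * X * U)"
    if "X \<in> carrier_mat p p" for X
    unfolding Tadj using that dims
    by (simp add: T_def smult_mult_dim mult_smult_dim \<beta>\<beta> smult_smult_mat)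
  define Cs where "Cs = map (\<lambda>A. V\<^sup>\<dagger> * A * T) As"
  have Cs: "set Cs \<subseteq> carrier_mat n p" using As V(1) Tc by (auto simp: Cs_def)
  have CX: "cp_map n Cs X = complex_of_real \<beta> \<cdot>\<^sub>m (V\<^sup>\<dagger> * cp_map n As (U * X * U\<^sup>\<dagger>) * V)"
    if X: "X \<in> carrier_mat p p" for X
  proof -
    have Uc: "U * X * U\<^sup>\<dagger> \<in> carrier_mat p p"
      using U X by (auto intro!: carrier_matI)
    have "cp_map n Cs X = V\<^sup>\<dagger> * cp_map n As (complex_of_real \<beta> \<cdot>\<^sub>m (U * X * U\<^sup>\<dagger>)) * V"
      unfolding Cs_def using cp_map_conjugate[OF As _ Tc X, of "V\<^sup>\<dagger>"] V(1) TX[OF X] by simp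
    also have "\<dots> = complex_of_real \<beta> \<cdot>\<^sub>m (V\<^sup>\<dagger> * cp_map n As (U * X * U\<^sup>\<dagger>) * V)"
      unfolding cp_map_smult[OF As Uc] using dims As by (simp add: smult_mult_dim mult_smult_dim)
    finally show ?thesis .
  qed
  have Cunital: "cp_map n Cs (1\<^sub>m p) = 1\<^sub>m n"
  proof -
    have "cp_map n Cs (1\<^sub>m p) = complex_of_real (\<beta> * (s / real n)) \<cdot>\<^sub>m 1\<^sub>m n"
      using CX[of "1\<^sub>m p"] UU dims V one
      by (simp add: smult_mult_dim mult_smult_dim smult_smult_mat)
    also have "\<beta> * (s / real n) = 1" using s np by (simp add: \<beta>_def)
    finally show ?thesis by (auto intro: eq_matI)
  qed
  have Cdual: "cp_dual p Cs (1\<^sub>m n) = rdiag p (\<lambda>_. \<kappa>)"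
  proof -
    have "cp_dual p Cs (1\<^sub>m n) = T\<^sup>\<dagger> * cp_dual p As (1\<^sub>m n) * T"
      unfolding Cs_def using cp_dual_conjugate[OF As _ Tc, of "V\<^sup>\<dagger>" "1\<^sub>m n"] V(1) VV by simp
    also have "\<dots> = complex_of_real (\<beta> * (s / real p)) \<cdot>\<^sub>m 1\<^sub>m p"
      using TT[of "cp_dual p As (1\<^sub>m n)"] As dims U unfolding dual_one
      by (simp add: smult_mult_dim mult_smult_dim smult_smult_mat)
    also have "\<beta> * (s / real p) = \<kappa>" using s by (simp add: \<beta>_def \<kappa>_def)
    finally show ?thesis by (auto intro: eq_matI)
  qed
  have Cgap: "frobenius_norm (cp_map n Cs X) \<le> (1 - l) * sqrt \<kappa> * frobenius_norm X"
    if X: "hermitian_mat p X" "mat_trace X = 0" for X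
  proof -
    have Xc: "X \<in> carrier_mat p p" using X by (simp add: hermitian_mat_def)
    let ?X = "U * X * U\<^sup>\<dagger>"
    have "frobenius_norm (V\<^sup>\<dagger> * cp_map n As ?X * V) = frobenius_norm (cp_map n As ?X)"
      using frobenius_norm_unitary_conjugate[of "V\<^sup>\<dagger>" n "cp_map n As ?X"] V(1) VV As by simp
    then have "frobenius_norm (cp_map n Cs X) = \<beta> * frobenius_norm (cp_map n As ?X)"
      unfolding CX[OF Xc] frobenius_norm_smult using \<beta> by simp
    also have "\<dots> \<le> \<beta> * ((1 - l) * (s / sqrt (real n * real p)) * frobenius_norm ?X)"
      using expand[OF hermitian_conjugate[OF X(1) U(1)]] X(2) mat_trace_unitary_conjugate[OF U Xc] \<beta>
      by (intro mult_left_mono) auto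
    also have "frobenius_norm ?X = frobenius_norm X"
      by (rule frobenius_norm_unitary_conjugate[OF U Xc])
    also have "\<beta> * ((1 - l) * (s / sqrt (real n * real p)) * frobenius_norm X)
        = (1 - l) * (real n / sqrt (real n * real p)) * frobenius_norm X" using s by (simp add: \<beta>_def)
    also have "real n / sqrt (real n * real p) = sqrt \<kappa>"
      using np
      by (simp add: \<kappa>_def real_sqrt_mult real_sqrt_divide real_div_sqrt flip: divide_divide_eq_left)
    finally show ?thesis .
  qed

  \<comment> \<open>The nonnegative weights of \<open>Cs\<close>\<close>
  define b where "b = kraus_weight Cs"
  have b: "0 \<le> b j i" for j i by (simp add: b_def)
  have row: "(\<Sum>i<p. b j i) = 1" if "j < n" for j
    using cp_map_rdiag_index[OF Cs that, of "\<lambda>_. 1"] that Cunital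
    by (simp add: rdiag_one b_def flip: of_real_sum)
  have col: "(\<Sum>j<n. b j i) = \<kappa>" if "i < p" for i
    using cp_dual_rdiag_index[OF Cs that, of "\<lambda>_. 1"] that Cdual
    by (simp add: rdiag_one b_def flip: of_real_sum)
  define Y where "Y = (\<lambda>j. \<beta> * y j)"
  have Y: "Y j = (\<Sum>i<p. b j i * z i)" if "j < n" for j
  proof -
    have "cp_map n Cs (rdiag p z) = complex_of_real \<beta> \<cdot>\<^sub>m rdiag n y"
      using CX[of "rdiag p z"] PhiZ dims V unfolding Ze[symmetric]
      by (simp add: mult_assoc_dim mult_cancel_dim)
    then have "complex_of_real (Y j) = complex_of_real (\<Sum>i<p. b j i * z i)"
      using cp_map_rdiag_index[OF Cs that, of z] that by (simp add: b_def Y_def)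
    then show ?thesis by (simp only: of_real_eq_iff)
  qed
  \<comment> \<open>\<open>hermitian_spectral\<close> gives no sign for \<open>y\<close>. Positivity
    holds because each row of \<open>b\<close> sums to 1 and so contains a positive weight.\<close>
  have Ypos: "0 < Y j" if j: "j < n" for j
  proof -
    have "0 \<le> (\<Sum>i<p. b j i * z i)" using b z by (intro sum_nonneg) (auto simp: less_imp_le)
    moreover have "(\<Sum>i<p. b j i * z i) \<noteq> 0"
    proof
      assume "(\<Sum>i<p. b j i * z i) = 0"
      then have "\<forall>i\<in>{..<p}. b j i * z i = 0"
        using b z by (subst (asm) sum_nonneg_eq_0_iff) (auto simp: less_imp_le)
      then have "\<forall>i\<in>{..<p}. b j i = 0" using z by force
      then show False using row[OF j] by simp
    qed
    ultimately show ?thesis using Y[OF j] by simp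
  qed
  have y: "0 < y j"
    if "j < n" for j using Ypos[OF that] \<beta> by (simp add: Y_def zero_less_mult_iff)

  \<comment> \<open>Factors of \<open>Z\<close> and of the inverse of its image\<close>
  define L where "L = U * rdiag p (\<lambda>i. sqrt (z i))"
  define K where "K = rdiag p (\<lambda>i. 1 / sqrt (z i)) * U\<^sup>\<dagger>"
  \<comment> \<open>\<open>P\<close> omits the leading \<open>V\<close> of the inverse square root
    of the image, as \<open>L\<close> omits the trailing \<open>U\<^sup>\<dagger>\<close> of the
    square root of \<open>Z\<close>; so \<open>P * A * L\<close> is a diagonal scaling of
    \<open>V\<^sup>\<dagger> * A * U\<close>.\<close>
  define P where "P = rdiag n (\<lambda>j. 1 / sqrt (y j)) * V\<^sup>\<dagger>"
  define J where "J = V * rdiag n (\<lambda>j. sqrt (y j))"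
  have Lc: "L \<in> carrier_mat p p" "K \<in> carrier_mat p p" and Pc: "P \<in> carrier_mat n n" "J \<in> carrier_mat n n"
    using U V by (auto simp: L_def K_def P_def J_def)
  have dims2: "dim_row L = p" "dim_col L = p" "dim_row P = n" "dim_col P = n"
    using Lc Pc by auto
  have zi: "rdiag p (\<lambda>i. sqrt (z i)) * rdiag p (\<lambda>i. 1 / sqrt (z i)) = 1\<^sub>m p"
  proof (rule rdiag_inverse)
    fix i assume "i < p" then show "sqrt (z i) * (1 / sqrt (z i)) = 1" using z[of i] by simp
  qed
  have yi: "rdiag n (\<lambda>j. 1 / sqrt (y j)) * rdiag n (\<lambda>j. sqrt (y j)) = 1\<^sub>m n"
  proof (rule rdiag_inverse)
    fix i assume "i < n" then show "1 / sqrt (y i) * sqrt (y i) = 1" using y[of i] by simp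
  qed
  have LK: "L * K = 1\<^sub>m p"
    using dims zi UU by (simp add: L_def K_def mult_assoc_dim mult_cancel_dim)
  have PJ: "P * J = 1\<^sub>m n"
    using dims yi V by (simp add: P_def J_def mult_assoc_dim mult_cancel_dim)
  have zz: "rdiag p (\<lambda>i. sqrt (z i)) * rdiag p (\<lambda>i. sqrt (z i)) = rdiag p z"
    unfolding rdiag_mult by (rule rdiag_cong) (use z in \<open>auto simp: less_imp_le\<close>)
  have "L * L\<^sup>\<dagger> = U * (rdiag p (\<lambda>i. sqrt (z i)) * rdiag p (\<lambda>i. sqrt (z i))) * U\<^sup>\<dagger>"
    using dims by (simp add: L_def adjoint_mult mult_assoc_dim)
  then have LL: "L * L\<^sup>\<dagger> = Z" unfolding zz Ze by simp
  have yy: "rdiag n (\<lambda>j. 1 / sqrt (y j)) * rdiag n (\<lambda>j. 1 / sqrt (y j)) = rdiag n (\<lambda>j. 1 / y j)"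
    unfolding rdiag_mult by (rule rdiag_cong) (use y in \<open>auto simp: less_imp_le\<close>)
  have "P\<^sup>\<dagger> * P = V * (rdiag n (\<lambda>j. 1 / sqrt (y j)) * rdiag n (\<lambda>j. 1 / sqrt (y j))) * V\<^sup>\<dagger>"
    using dims by (simp add: P_def adjoint_mult mult_assoc_dim)
  then have PP: "P\<^sup>\<dagger> * P = V * rdiag n (\<lambda>j. 1 / y j) * V\<^sup>\<dagger>"
    unfolding yy by simp
  have yyi: "rdiag n y * rdiag n (\<lambda>j. 1 / y j) = 1\<^sub>m n"
  proof (rule rdiag_inverse)
    fix i assume "i < n" then show "y i * (1 / y i) = 1" using y[of i] by simp
  qed
  have W: "P\<^sup>\<dagger> * P = mat_inv (cp_map n As Z)"
  proof (rule sym, rule mat_inv_eqI[of _ n])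
    show "cp_map n As Z * (P\<^sup>\<dagger> * P) = 1\<^sub>m n"
      unfolding PP PhiZ using dims V VV yyi by (simp add: mult_assoc_dim mult_cancel_dim)
  qed (use As Pc in auto)
  have PZP: "P * cp_map n As Z * P\<^sup>\<dagger> = 1\<^sub>m n"
  proof -
    have "rdiag n y = rdiag n (\<lambda>j. sqrt (y j)) * rdiag n (\<lambda>j. sqrt (y j))"
      unfolding rdiag_mult by (rule rdiag_cong) (use y in \<open>auto simp: less_imp_le\<close>)
    moreover have "rdiag n (\<lambda>j. sqrt (y j)) * rdiag n (\<lambda>j. 1 / sqrt (y j)) = 1\<^sub>m n"
      using mat_mult_left_right_inverse[OF _ _ yi] by simp
    ultimately show ?thesis
      unfolding PhiZ using dims V yi
      by (simp add: P_def adjoint_mult mult_assoc_dim mult_cancel_dim)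
  qed

  \<comment> \<open>The normalised operators \<open>Bs\<close> and their spectral gap\<close>
  define Bs where "Bs = map (\<lambda>A. P * A * L) As"
  have Bs: "set Bs \<subseteq> carrier_mat n p" using As Lc Pc by (auto simp: Bs_def)
  have PAL: "(P * A * L) $$ (j, i) = complex_of_real (sqrt (z i) / sqrt (y j)) * (V\<^sup>\<dagger> * A * U) $$ (j, i)"
    "(V\<^sup>\<dagger> * A * T) $$ (j, i) = complex_of_real (sqrt \<beta>) * (V\<^sup>\<dagger> * A * U) $$ (j, i)"
    if "A \<in> carrier_mat n p" "j < n" "i < p" for A j i
  proof -
    have "P * A * L = rdiag n (\<lambda>j. 1 / sqrt (y j)) * (V\<^sup>\<dagger> * A * U) * rdiag p (\<lambda>i. sqrt (z i))"
      using that(1) dims by (simp add: P_def L_def mult_assoc_dim)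
    then show "(P * A * L) $$ (j, i) = complex_of_real (sqrt (z i) / sqrt (y j)) * (V\<^sup>\<dagger> * A * U) $$ (j, i)"
      using that dims by (simp del: index_mult_mat(1))
    have "V\<^sup>\<dagger> * A * T = complex_of_real (sqrt \<beta>) \<cdot>\<^sub>m (V\<^sup>\<dagger> * A * U)"
      using that(1) dims by (simp add: T_def mult_smult_dim)
    then show "(V\<^sup>\<dagger> * A * T) $$ (j, i) = complex_of_real (sqrt \<beta>) * (V\<^sup>\<dagger> * A * U) $$ (j, i)"
      using that dims by (simp del: index_mult_mat(1))
  qed
  \<comment> \<open>The factor \<open>\<beta>\<close> in the weights of \<open>Cs\<close> cancels
    against the one in \<open>Y\<close>.\<close>
  have Bb: "kraus_weight Bs j i = b j i * (z i / Y j)" if ji: "j < n" "i < p" for j i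
  proof -
    have "(cmod ((P * A * L) $$ (j, i)))\<^sup>2 = (cmod ((V\<^sup>\<dagger> * A * T) $$ (j, i)))\<^sup>2 * (z i / Y j)"
      if A: "A \<in> set As" for A
    proof -
      have Ac: "A \<in> carrier_mat n p" using A As by auto
      show ?thesis
        unfolding PAL[OF Ac ji] norm_mult norm_of_real power_mult_distrib power2_abs
        using z[OF ji(2)] y[OF ji(1)] \<beta> by (simp add: power_divide Y_def)
    qed
    then have "kraus_weight Bs j i = (\<Sum>A\<leftarrow>As. (cmod ((V\<^sup>\<dagger> * A * T) $$ (j, i)))\<^sup>2 * (z i / Y j))"
      unfolding kraus_weight_def Bs_def map_map comp_def
      by (intro arg_cong[of _ _ sum_list] map_cong) auto
    then show ?thesis
      unfolding b_def kraus_weight_def Cs_def map_map comp_def by (simp only: sum_list_mult_const)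
  qed
  define H where "H = cp_dual p Bs (1\<^sub>m n)"
  have Hc: "H \<in> carrier_mat p p" using Bs by (simp add: H_def)
  have He: "H = L\<^sup>\<dagger> * cp_dual p As (mat_inv (cp_map n As Z)) * L"
    unfolding H_def Bs_def using cp_dual_conjugate[OF As Pc(1) Lc(1), of "1\<^sub>m n"] dims2 W by simp
  define G where "G = complex_of_real (1 / \<kappa>) \<cdot>\<^sub>m H - 1\<^sub>m p"
  have Gc: "G \<in> carrier_mat p p" by (simp add: G_def minus_carrier_mat)
  have FG: "frobenius_norm G = \<gamma>"
    unfolding \<gamma>_def geodesic_grad_def G_def He \<kappa>i LL[symmetric]
    by (rule frobenius_norm_gram_factor[symmetric, OF Lc LK]) (use As in simp)
  \<comment> \<open>The diagonal of the gradient in the eigenbasis of \<open>Z\<close>; dropping the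
    other entries only lowers the norm, as \<open>g0n\<close> records.\<close>
  define g0 where "g0 = (\<lambda>i. Re (G $$ (i, i)))"
  have g0: "(\<Sum>j<n. b j i * (z i / Y j)) = \<kappa> * (1 + g0 i)" if i: "i < p" for i
  proof -
    have "H $$ (i, i) = complex_of_real (\<Sum>j<n. b j i * (z i / Y j))"
      using cp_dual_rdiag_index[OF Bs i, of "\<lambda>_. 1"] Bb[OF _ i]
      by (simp add: rdiag_one H_def)
    then have "g0 i = 1 / \<kappa> * (\<Sum>j<n. b j i * (z i / Y j)) - 1"
      unfolding g0_def G_def using i carrier_matD[OF Hc] by simp
    then show ?thesis using \<kappa> by (simp add: field_simps)
  qed
  have g0n: "sqrt (\<Sum>i<p. (g0 i)\<^sup>2) \<le> \<gamma>"
  proof -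
    have "(\<Sum>i<p. (g0 i)\<^sup>2) \<le> (\<Sum>i<p. (cmod (G $$ (i, i)))\<^sup>2)"
      unfolding g0_def by (intro sum_mono) (metis abs_Re_le_cmod abs_ge_zero power2_abs power_mono)
    also have "\<dots> \<le> \<gamma>\<^sup>2" using frobenius_norm_diag_le[OF Gc] FG by simp
    finally show ?thesis using \<gamma> by (simp add: real_le_lsqrt sum_nonneg)
  qed
  \<comment> \<open>The gap for diagonal matrices of trace zero; restricting the image to its
    diagonal can only decrease the norm.\<close>
  have Cgap': "(\<Sum>j<n. (\<Sum>i<p. b j i * x i)\<^sup>2) \<le> (1 - l)\<^sup>2 * \<kappa> * (\<Sum>i<p. (x i)\<^sup>2)"
    if x: "(\<Sum>i<p. x i) = 0" for x
  proof -
    have "(\<Sum>j<n. (\<Sum>i<p. b j i * x i)\<^sup>2) = (\<Sum>j<n. (cmod (cp_map n Cs (rdiag p x) $$ (j, j)))\<^sup>2)"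
      using cp_map_rdiag_index[OF Cs, of _ x]
      by (auto simp: b_def norm_of_real simp del: of_real_sum of_real_mult intro!: sum.cong)
    also have "\<dots> \<le> (frobenius_norm (cp_map n Cs (rdiag p x)))\<^sup>2"
      using Cs by (intro frobenius_norm_diag_le) simp
    also have "\<dots> \<le> ((1 - l) * sqrt \<kappa> * frobenius_norm (rdiag p x))\<^sup>2"
    proof (intro power_mono Cgap)
      have "mat_trace (rdiag p x) = complex_of_real (\<Sum>i<p. x i)" by (simp add: mat_trace_def)
      then show "mat_trace (rdiag p x) = 0" by (simp add: x)
    qed auto
    also have "\<dots> = (1 - l)\<^sup>2 * \<kappa> * (\<Sum>i<p. (x i)\<^sup>2)"
      using \<kappa> by (simp add: power_mult_distrib frobenius_norm_rdiag)
    finally show ?thesis .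
  qed
  have \<gamma>8: "\<gamma> \<le> l / 8" using \<gamma> l2 l by linarith
  obtain \<alpha> where \<alpha>: "0 < \<alpha>" and az: "\<And>i. i < p \<Longrightarrow> \<bar>ln (\<alpha> * z i)\<bar> \<le> 4 * \<gamma> / l"
    and aY: "\<And>j. j < n \<Longrightarrow> 0 < Y j \<and> \<bar>ln (\<alpha> * Y j)\<bar> \<le> 4 * \<gamma> / l"
    by (rule expander_scaling_near_constant[OF np(2) l \<kappa> b row col Cgap' z Y g0 g0n \<gamma>8]) auto
  \<comment> \<open>The bound \<open>\<gamma> \<le> l\<^sup>2 / 64\<close> gives exactly the
    \<open>\<epsilon> \<le> l / 16\<close> that \<open>scaled_expander\<close> asks for.\<close>
  define \<epsilon> where "\<epsilon> = 4 * \<gamma> / l"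
  have \<epsilon>: "0 \<le> \<epsilon>" "\<epsilon> \<le> l / 16"
    using \<gamma> l by (auto simp: \<epsilon>_def field_simps power2_eq_square)
  \<comment> \<open>\<open>\<alpha>\<close> cancels in \<open>v j * u i\<close>, so it may be used
    to centre both scalings at 1.\<close>
  define u where "u = (\<lambda>i. sqrt (\<alpha> * z i))"
  define v where "v = (\<lambda>j. 1 / sqrt (\<alpha> * Y j))"
  have sqrt_exp: "sqrt x = exp (ln x / 2)" if "0 < x" for x :: real
    using that by (simp add: ln_sqrt[symmetric])
  have u: "exp (- \<epsilon> / 2) \<le> u i \<and> u i \<le> exp (\<epsilon> / 2)" if "i < p" for i
    using az[OF that] \<alpha> z[OF that] unfolding u_def \<epsilon>_def[symmetric]
    by (subst (1 2) sqrt_exp) (auto simp: abs_le_iff)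
  have v: "0 \<le> v j \<and> v j \<le> exp (\<epsilon> / 2)" if "j < n" for j
  proof -
    have "0 < \<alpha> * Y j" using \<alpha> aY[OF that] by simp
    then have "v j = exp (- (ln (\<alpha> * Y j) / 2))"
      unfolding v_def by (subst sqrt_exp) (auto simp: exp_minus field_simps)
    then show ?thesis using aY[OF that] by (auto simp: \<epsilon>_def[symmetric] abs_le_iff)
  qed
  have BsC: "Bs = map (\<lambda>C. rdiag n v * C * rdiag p u) Cs"
  proof -
    have "P * A * L = rdiag n v * (V\<^sup>\<dagger> * A * T) * rdiag p u" if "A \<in> set As" for A
    proof (rule eq_matI)
      have A: "A \<in> carrier_mat n p" using As that by auto
      fix j i assume "j < dim_row (rdiag n v * (V\<^sup>\<dagger> * A * T) * rdiag p u)" "i < dim_col (rdiag n v * (V\<^sup>\<dagger> * A * T) * rdiag p u)"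
      then have ji: "j < n" "i < p" by auto
      have real: "v j * sqrt \<beta> * u i = sqrt (z i) / sqrt (y j)"
        using \<alpha> \<beta> y[OF ji(1)] z[OF ji(2)]
        by (simp add: u_def v_def Y_def real_sqrt_mult)
      have "(rdiag n v * (V\<^sup>\<dagger> * A * T) * rdiag p u) $$ (j, i) = complex_of_real (v j) * (V\<^sup>\<dagger> * A * T) $$ (j, i) * complex_of_real (u i)"
        using ji A dims carrier_matD[OF Tc] by (simp del: index_mult_mat(1))
      also have "\<dots> = complex_of_real (v j * sqrt \<beta> * u i) * (V\<^sup>\<dagger> * A * U) $$ (j, i)"
        unfolding PAL[OF A ji] by simp
      finally show "(P * A * L) $$ (j, i) = (rdiag n v * (V\<^sup>\<dagger> * A * T) * rdiag p u) $$ (j, i)"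
        unfolding PAL[OF A ji] real by simp
    qed (use dims2 in auto)
    then show ?thesis by (simp add: Bs_def Cs_def)
  qed
  have Bgap: "frobenius_norm (cp_map n Bs X) \<le> (1 - l / 2) * sqrt \<kappa> * frobenius_norm X"
    if "hermitian_mat p X" "mat_trace X = 0" for X
    unfolding BsC
    by (rule scaled_expander[OF Cs \<kappa> l Cunital Cdual Cgap u v \<epsilon> that]) auto

  \<comment> \<open>Eigenbases of the gradient and of the next image; the operators
    \<open>Ds\<close>\<close>
  have "hermitian_mat p H"
    unfolding H_def cp_dual_eq_cp_map
    by (rule cp_map_hermitian[OF adjoint_set_carrier[OF Bs]]) (simp add: hermitian_mat_def)
  then obtain Q e where Q: "Q \<in> carrier_mat p p" "Q\<^sup>\<dagger> * Q = 1\<^sub>m p" and HQ: "H = Q * rdiag p e * Q\<^sup>\<dagger>"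
    using hermitian_spectral by blast
  have QQ: "Q * Q\<^sup>\<dagger> = 1\<^sub>m p"
    using mat_mult_left_right_inverse[OF _ Q] Q(1) by auto
  define g where "g = (\<lambda>i. e i / \<kappa> - 1)"
  have eg: "\<kappa> * (1 + g i) = e i" for i using \<kappa> by (simp add: g_def)
  have GQ: "G = Q * rdiag p g * Q\<^sup>\<dagger>"
  proof -
    have "complex_of_real (1 / \<kappa>) \<cdot>\<^sub>m rdiag p e = rdiag p g + 1\<^sub>m p"
      by (rule eq_matI) (auto simp: g_def)
    then have "complex_of_real (1 / \<kappa>) \<cdot>\<^sub>m H = Q * (rdiag p g + 1\<^sub>m p) * Q\<^sup>\<dagger>"
      using HQ Q
      by (metis carrier_matD mult_smult_dim smult_mult_dim rdiag_dim index_mult_mat(3) adjoint_dim(1))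
    also have "\<dots> = Q * rdiag p g * Q\<^sup>\<dagger> + 1\<^sub>m p"
      using Q QQ by (simp add: mult_add_dim add_mult_dim)
    finally show ?thesis unfolding G_def using Q
    by (auto intro!: eq_matI simp del: index_mult_mat(1))
  qed
  have Fg: "frobenius_norm (rdiag p g) = \<gamma>"
    using FG unfolding GQ frobenius_norm_unitary_conjugate[OF Q rdiag_carrier] .
  define q where "q = (\<lambda>i. 1 / (1 + g i))"
  define L' where "L' = L * Q"
  have L'c: "L' \<in> carrier_mat p p" using Lc Q by (simp add: L'_def)
  have L'X: "L' * X * L'\<^sup>\<dagger> = L * (Q * X * Q\<^sup>\<dagger>) * L\<^sup>\<dagger>"
    if "X \<in> carrier_mat p p" for X
    using that dims2 Q by (simp add: L'_def adjoint_mult mult_assoc_dim)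
  \<comment> \<open>\<open>balanced_contraction\<close> expects the image of the next iterate as
    \<open>rdiag n m\<close>. The left basis \<open>R\<close> is chosen to achieve this, and
    therefore depends on \<open>q\<close>.\<close>
  have "hermitian_mat n (P * cp_map n As (L' * rdiag p q * L'\<^sup>\<dagger>) * P\<^sup>\<dagger>)"
    by (intro hermitian_conjugate cp_map_hermitian[OF As] hermitian_rdiag L'c Pc)
  then obtain R m where R: "R \<in> carrier_mat n n" "R\<^sup>\<dagger> * R = 1\<^sub>m n"
    and Rm: "P * cp_map n As (L' * rdiag p q * L'\<^sup>\<dagger>) * P\<^sup>\<dagger> = R * rdiag n m * R\<^sup>\<dagger>"
    using hermitian_spectral by blast
  have RR: "R * R\<^sup>\<dagger> = 1\<^sub>m n"
    using mat_mult_left_right_inverse[OF _ R] R(1) by auto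
  define P' where "P' = R\<^sup>\<dagger> * P"
  have P'c: "P' \<in> carrier_mat n n" using Pc R by (auto simp: P'_def)
  define Ds where "Ds = map (\<lambda>A. P' * A * L') As"
  have Ds: "set Ds \<subseteq> carrier_mat n p" using As P'c L'c by (auto simp: Ds_def)
  have DX: "cp_map n Ds X = R\<^sup>\<dagger> * (P * cp_map n As (L' * X * L'\<^sup>\<dagger>) * P\<^sup>\<dagger>) * R"
    if "X \<in> carrier_mat p p" for X
    unfolding Ds_def cp_map_conjugate[OF As P'c L'c that] using dims2 R As
    by (simp add: P'_def adjoint_mult mult_assoc_dim)
  have DB: "cp_map n Ds X = R\<^sup>\<dagger> * cp_map n Bs (Q * X * Q\<^sup>\<dagger>) * R"
    if X: "X \<in> carrier_mat p p" for X
  proof -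
    have "Q * X * Q\<^sup>\<dagger> \<in> carrier_mat p p" using Q X by (auto intro!: carrier_matI)
    then show ?thesis unfolding DX[OF X] L'X[OF X] Bs_def using cp_map_conjugate[OF As Pc(1) Lc(1)] by simp
  qed
  have P'P': "P'\<^sup>\<dagger> * P' = mat_inv (cp_map n As Z)"
    unfolding W[symmetric] using dims2 R RR
    by (simp add: P'_def adjoint_mult mult_assoc_dim mult_cancel_dim)
  have Dunital: "cp_map n Ds (1\<^sub>m p) = 1\<^sub>m n"
    using DX[of "1\<^sub>m p"] L'X[of "1\<^sub>m p"] LL PZP QQ dims2 Q R by simp
  have Ddual: "cp_dual p Ds (1\<^sub>m n) = rdiag p (\<lambda>i. \<kappa> * (1 + g i))"
  proof -
    have "cp_dual p Ds (1\<^sub>m n) = L'\<^sup>\<dagger> * cp_dual p As (mat_inv (cp_map n As Z)) * L'"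
      unfolding Ds_def using cp_dual_conjugate[OF As P'c L'c, of "1\<^sub>m n"] P'P' P'c by simp
    also have "\<dots> = Q\<^sup>\<dagger> * H * Q"
      unfolding He using dims2 Q carrier_matD[OF cp_dual_carrier[OF As]]
      by (simp add: L'_def adjoint_mult mult_assoc_dim)
    also have "\<dots> = rdiag p e"
      unfolding HQ using Q by (simp add: mult_assoc_dim mult_cancel_dim)
    finally show ?thesis by (simp add: eg)
  qed
  have Dm: "cp_map n Ds (rdiag p (\<lambda>i. 1 / (1 + g i))) = rdiag n m"
    unfolding q_def[symmetric] DX[OF rdiag_carrier] Rm using R
    by (simp add: mult_assoc_dim mult_cancel_dim)
  \<comment> \<open>The total weight of \<open>Ds\<close> is counted by columns and by rows; since
    \<open>\<kappa> * p\<close> is \<open>n\<close>, the gradient has trace zero.\<close>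
  have gsum: "(\<Sum>i<p. g i) = 0"
  proof -
    have "(\<Sum>i<p. \<kappa> * (1 + g i)) = (\<Sum>i<p. \<Sum>j<n. kraus_weight Ds j i)"
    proof (intro sum.cong refl)
      fix i assume "i \<in> {..<p}"
      then have i: "i < p" by simp
      have "complex_of_real (\<kappa> * (1 + g i)) = complex_of_real (\<Sum>j<n. kraus_weight Ds j i)"
        using cp_dual_rdiag_index[OF Ds i, of "\<lambda>_. 1"] Ddual i by (simp add: rdiag_one)
      then show "\<kappa> * (1 + g i) = (\<Sum>j<n. kraus_weight Ds j i)"
        by (simp only: of_real_eq_iff)
    qed
    also have "\<dots> = (\<Sum>j<n. \<Sum>i<p. kraus_weight Ds j i)" by (rule sum.swap)
    also have "\<dots> = (\<Sum>j<n. 1)"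
    proof (intro sum.cong refl)
      fix j assume "j \<in> {..<n}"
      then have j: "j < n" by simp
      show "(\<Sum>i<p. kraus_weight Ds j i) = 1"
        using cp_map_rdiag_index[OF Ds j, of "\<lambda>_. 1"] j Dunital
        by (simp add: rdiag_one flip: of_real_sum)
    qed
    finally have "\<kappa> * (real p + (\<Sum>i<p. g i)) = real n"
      by (simp add: sum.distrib flip: sum_distrib_left)
    then show ?thesis using np by (simp add: \<kappa>_def field_simps)
  qed
  have Dgap: "frobenius_norm (cp_map n Ds (rdiag p g)) \<le> (1 - l / 2) * sqrt \<kappa> * \<gamma>"
  proof -
    have "frobenius_norm (cp_map n Ds (rdiag p g)) = frobenius_norm (cp_map n Bs G)"
      unfolding DB[OF rdiag_carrier] GQ[symmetric]
      using frobenius_norm_unitary_conjugate[of "R\<^sup>\<dagger>" n "cp_map n Bs G"] R(1) RR Bs by simp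
    also have "\<dots> \<le> (1 - l / 2) * sqrt \<kappa> * frobenius_norm G"
    proof (rule Bgap)
      show "hermitian_mat p G" unfolding GQ by (intro hermitian_conjugate hermitian_rdiag Q)
      have "mat_trace G = mat_trace (rdiag p g)"
        unfolding GQ by (rule mat_trace_unitary_conjugate[OF Q rdiag_carrier])
      also have "\<dots> = complex_of_real (\<Sum>i<p. g i)" by (simp add: mat_trace_def)
      finally show "mat_trace G = 0" by (simp add: gsum)
    qed
    finally show ?thesis by (simp add: FG)
  qed
  note bc = balanced_contraction[OF Ds \<kappa> l Dunital Ddual Dm Dgap Fg \<gamma>(2)]
  have K'c: "Q\<^sup>\<dagger> * K \<in> carrier_mat p p" and J'c: "J * R \<in> carrier_mat n n"
    using Q R Lc Pc by auto
  have LK': "L' * (Q\<^sup>\<dagger> * K) = 1\<^sub>m p"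
    using dims2 Q QQ LK Lc by (simp add: L'_def mult_assoc_dim mult_cancel_dim)
  have PJ': "P' * (J * R) = 1\<^sub>m n"
    using dims2 R PJ Pc by (simp add: P'_def mult_assoc_dim mult_cancel_dim)
  have q0: "0 < q i" if "i < p" for i using bc(1)[OF that] by (simp add: q_def)
  have Ddual': "cp_dual p Ds (1\<^sub>m n) = rdiag p (\<lambda>i. \<kappa> * (1 / q i))"
    unfolding Ddual by (simp add: q_def)
  note sc = sinkhorn_step_coordinates[OF As np L'c K'c LK' P'c J'c PJ' P'P' Ds_def \<kappa>_def q0 bc(2) Ddual' Dm[folded q_def]]
  show "sinkhorn_step n p As Z \<in> PD p" by (rule sc(1))
  have "frobenius_norm (geodesic_grad n p As (sinkhorn_step n p As Z)) =
      frobenius_norm (complex_of_real (1 / \<kappa>) \<cdot>\<^sub>m (rdiag p (\<lambda>i. sqrt (q i))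
        * cp_dual p Ds (rdiag n (\<lambda>j. 1 / m j)) * rdiag p (\<lambda>i. sqrt (q i))) - 1\<^sub>m p)"
    by (rule sc(2))
  also have "\<dots> \<le> (1 - l / 4) * \<gamma>" using bc(3) by (simp only: q_def)
  finally show "frobenius_norm (geodesic_grad n p As (sinkhorn_step n p As Z))
      \<le> (1 - l / 4) * frobenius_norm (geodesic_grad n p As Z)" by (simp only: \<gamma>_def)
qed

theorem theorem2p11:
  shows "\<exists>c c' :: real. c > 0 \<and> c' > 0 \<and>
    (\<forall>(n::nat) (p::nat) (l::real) (As :: complex mat list) (Z\<^sub>0 :: complex mat).
       n \<ge> 1 \<longrightarrow> p \<ge> 1 \<longrightarrow> 0 < l \<longrightarrow> l \<le> 1 \<longrightarrow>
       quantum_expander n p (1 - l) As \<longrightarrow>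
       Z\<^sub>0 \<in> PD p \<longrightarrow>
       frobenius_norm (geodesic_grad n p As Z\<^sub>0) \<le> c * l\<^sup>2 \<longrightarrow>
       (\<forall>T::nat. frobenius_norm (geodesic_grad n p As (sinkhorn n p As Z\<^sub>0 T))
                  \<le> exp (- c' * l * real T)))"
proof (rule exI[of _ "1 / 64"], rule exI[of _ "1 / 4"], intro conjI allI impI)
  fix n p :: nat and l :: real and As :: "complex mat list" and Z\<^sub>0 :: "complex mat" and T :: nat
  assume np: "n \<ge> 1" "p \<ge> 1" and l: "0 < l" "l \<le> 1" and qe: "quantum_expander n p (1 - l) As"
    and Z0: "Z\<^sub>0 \<in> PD p" and small: "frobenius_norm (geodesic_grad n p As Z\<^sub>0) \<le> 1 / 64 * l\<^sup>2"
  let ?E = "\<lambda>T. exp (- (1 / 4) * l * real T)"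
  \<comment> \<open>Strengthened for the induction: the factor \<open>l\<^sup>2 / 64\<close> keeps
    the gradient in the range where a step contracts, and positive definiteness allows the next
    step. The factor is at most 1 and is dropped at the end.\<close>
  have "sinkhorn n p As Z\<^sub>0 T \<in> PD p \<and>
      frobenius_norm (geodesic_grad n p As (sinkhorn n p As Z\<^sub>0 T)) \<le> ?E T * (l\<^sup>2 / 64)"
  proof (induction T)
    case 0
    then show ?case using Z0 small by simp
  next
    case (Suc T)
    let ?Z = "sinkhorn n p As Z\<^sub>0 T" and ?Z' = "sinkhorn n p As Z\<^sub>0 (Suc T)"
    have Z': "?Z' = sinkhorn_step n p As ?Z" by (simp add: sinkhorn_step_def)
    have "?E T * (l\<^sup>2 / 64) \<le> 1 * (l\<^sup>2 / 64)"
      using l by (intro mult_right_mono) auto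
    then have "frobenius_norm (geodesic_grad n p As ?Z) \<le> l\<^sup>2 / 64"
      using Suc.IH by linarith
    note step = sinkhorn_step_contraction[OF np l qe conjunct1[OF Suc.IH] this]
    have "frobenius_norm (geodesic_grad n p As ?Z') \<le> (1 - l / 4) * frobenius_norm (geodesic_grad n p As ?Z)"
      unfolding Z' by (rule step(2))
    also have "\<dots> \<le> exp (- (l / 4)) * (?E T * (l\<^sup>2 / 64))"
      using Suc.IH exp_ge_add_one_self[of "- (l / 4)"] l by (intro mult_mono) auto
    also have "\<dots> = ?E (Suc T) * (l\<^sup>2 / 64)"
      by (simp add: algebra_simps add_divide_distrib flip: exp_add)
    finally show ?case using step(1) unfolding Z' by blast
  qed
  moreover have "?E T * (l\<^sup>2 / 64) \<le> ?E T * 1"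
    using l power_le_one[of l 2] by (intro mult_left_mono) auto
  ultimately show "frobenius_norm (geodesic_grad n p As (sinkhorn n p As Z\<^sub>0 T)) \<le> exp (- (1 / 4) * l * real T)"
    by linarith
qed auto

end
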